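(* Let $d\in\mathbb N$, fix $\boldsymbol\theta=(\theta_1,\ldots,\theta_d)\in\mathbb R^d$, and let $\psi:\mathbb N\to(0,\infty)$. Let $f$ be a dimension function satisfying: (I) there exist $s\in(d-1,d)$ and $C>0$ such that $f(y)\le C\,(y/x)^s f(x)$ for all $0<x<y$; (II) the map $x\mapsto x^{-d+1}f(x)$ is monotonically increasing on $(0,\infty)$. Let $\mathcal W^d_{\psi,\boldsymbol\theta}$ be the set of $\mathbf x=(x_1,\ldots,x_d)\in\mathbb R^d$ such that $\|qx_1-\theta_1\|\cdots\|qx_d-\theta_d\|<\psi(q)$ for infinitely many $q\in\mathbb N$. Then $$\mathcal H^f\big(\mathcal W^d_{\psi,\boldsymbol\theta}\cap[0,1]^d\big)=\begin{cases}0 & \text{if } \sum_{q=1}^\infty q^d\,\psi(q)^{-d+1} f\!\left(\frac{\psi(q)}{q}\right)<\infty,\\[1ex] \infty & \text{if } \sum_{q=1}^\infty q^d\,\psi(q)^{-d+1} f\!\left(\frac{\psi(q)}{q}\right)=\infty \text{ and } \psi \text{ is monotonic}.\end{cases}$$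
   Context: $\|\cdot\|$ denotes the distance from a real number to the nearest integer. A dimension function is an increasing continuous function $f:(0,\infty)\to(0,\infty)$ with $f(r)\to0$ as $r\to0$. For $S\subset\mathbb R^d$ and $\rho>0$, $\mathcal H^f_\rho(S)=\inf\sum_i f(\operatorname{diam}B_i)$, the infimum over all countable covers $\{B_i\}$ of $S$ by sets of diameter at most $\rho$; the Hausdorff $f$-measure is $\mathcal H^f(S)=\lim_{\rho\to0}\mathcal H^f_\rho(S)$. *)

theory Defs
  imports "HOL-Analysis.Analysis"
begin

definition dist_nearest_int :: "real \<Rightarrow> real" where
  "dist_nearest_int x = \<bar>x - of_int (round x)\<bar>"

text \<open>A function on \<open>(0,\<infinity>)\<close> is a total function of type \<^typ>\<open>real \<Rightarrow> real\<close> whose values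
  outside \<open>(0,\<infinity>)\<close> are never used.\<close>

definition dimension_function :: "(real \<Rightarrow> real) \<Rightarrow> bool" where
  "dimension_function f \<longleftrightarrow>
     (\<forall>r>0. f r > 0) \<and> mono_on {0<..} f \<and> continuous_on {0<..} f \<and> (f \<longlongrightarrow> 0) (at_right 0)"

text \<open>Covering sets with at most one point have diameter \<open>0\<close>, where \<open>f\<close> is extended by its
  limit \<open>0\<close>. Since empty sets are allowed, covers indexed by \<^typ>\<open>nat\<close> include finite ones.
  Boundedness is required because \<^const>\<open>diameter\<close> is unspecified on unbounded sets.\<close>

definition diam_weight :: "(real \<Rightarrow> real) \<Rightarrow> 'a::metric_space set \<Rightarrow> ennreal" where
  "diam_weight f B = (if diameter B = 0 then 0 else ennreal (f (diameter B)))"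

definition hausdorff_premeasure ::
    "(real \<Rightarrow> real) \<Rightarrow> real \<Rightarrow> 'a::metric_space set \<Rightarrow> ennreal" where
  "hausdorff_premeasure f \<rho> S =
     (INF B \<in> {B :: nat \<Rightarrow> 'a set. S \<subseteq> (\<Union>i. B i) \<and> (\<forall>i. bounded (B i) \<and> diameter (B i) \<le> \<rho>)}.
        \<Sum>i. diam_weight f (B i))"

definition hausdorff_measure :: "(real \<Rightarrow> real) \<Rightarrow> 'a::metric_space set \<Rightarrow> ennreal" where
  "hausdorff_measure f S = Lim (at_right 0) (\<lambda>\<rho>. hausdorff_premeasure f \<rho> S)"

text \<open>The limit always exists, by monotonicity in \<open>\<rho>\<close>.\<close>

lemma hausdorff_premeasure_antimono:
  assumes "\<rho> \<le> \<sigma>"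
  shows "hausdorff_premeasure f \<sigma> S \<le> hausdorff_premeasure f \<rho> S"
  unfolding hausdorff_premeasure_def
  by (rule INF_superset_mono) (use assms in \<open>auto intro: order_trans\<close>)

lemma hausdorff_premeasure_tendsto_SUP:
  "((\<lambda>\<rho>. hausdorff_premeasure f \<rho> S) \<longlongrightarrow> (SUP \<rho>\<in>{0<..}. hausdorff_premeasure f \<rho> S)) (at_right 0)"
proof (rule increasing_tendsto)
  show "\<forall>\<^sub>F \<rho> in at_right 0. hausdorff_premeasure f \<rho> S \<le> (SUP \<rho>\<in>{0<..}. hausdorff_premeasure f \<rho> S)"
    by (auto simp: eventually_at_filter intro!: always_eventually SUP_upper)
next
  fix x assume "x < (SUP \<rho>\<in>{0<..}. hausdorff_premeasure f \<rho> S)"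
  then obtain \<sigma> where \<sigma>: "\<sigma> > 0" "x < hausdorff_premeasure f \<sigma> S"
    by (auto simp: less_SUP_iff)
  have "\<forall>\<^sub>F \<rho> in at_right 0. \<rho> \<in> {0<..<\<sigma>}"
    using \<sigma>(1) by (rule eventually_at_right_real)
  then show "\<forall>\<^sub>F \<rho> in at_right 0. x < hausdorff_premeasure f \<rho> S"
  proof (rule eventually_mono)
    fix \<rho> assume "\<rho> \<in> {0<..<\<sigma>}"
    then have "hausdorff_premeasure f \<sigma> S \<le> hausdorff_premeasure f \<rho> S"
      by (intro hausdorff_premeasure_antimono) auto
    with \<sigma>(2) show "x < hausdorff_premeasure f \<rho> S"
      by (rule less_le_trans)
  qed
qed

lemma hausdorff_measure_eq_SUP:
  "hausdorff_measure f S = (SUP \<rho>\<in>{0<..}. hausdorff_premeasure f \<rho> S)"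
  unfolding hausdorff_measure_def
  by (rule tendsto_Lim[OF _ hausdorff_premeasure_tendsto_SUP]) simp

definition mult_approx_set :: "(nat \<Rightarrow> real) \<Rightarrow> real ^ 'd \<Rightarrow> (real ^ 'd) set" where
  "mult_approx_set \<psi> \<theta> =
     {x. infinite {q::nat. q \<ge> 1 \<and> (\<Prod>i\<in>UNIV. dist_nearest_int (real q * x $ i - \<theta> $ i)) < \<psi> q}}"

definition unit_cube :: "(real ^ 'd) set" where
  "unit_cube = {x. \<forall>i. 0 \<le> x $ i \<and> x $ i \<le> 1}"

text \<open>The index is shifted so that the sum starts at \<open>q = 1\<close>.\<close>

definition approx_series :: "nat \<Rightarrow> (nat \<Rightarrow> real) \<Rightarrow> (real \<Rightarrow> real) \<Rightarrow> ennreal" where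
  "approx_series d \<psi> f =
     (\<Sum>n. let q = Suc n in ennreal (real q ^ d * \<psi> q powi (1 - int d) * f (\<psi> q / real q)))"

end

theory Submission
  imports Defs
begin

text \<open>
  Put \<open>g x = x powr (1 - d) * f x\<close>; then \<open>g\<close> is increasing and \<open>g y \<le> C (y / x) powr t * g x\<close> for some
  \<open>t < 1\<close>, and the series is \<open>\<Sum> q g (\<psi> q / q)\<close>.

  Convergence. The points of the unit cube counted for \<open>q\<close> are split according to the dyadic size
  \<open>\<delta> = 2 ^ j \<psi> q\<close> of the smallest factor and covered by cubes of side \<open>\<delta> / q\<close>. Counting these cubes
  by a Markov inequality with an exponent between \<open>s - d + 1\<close> and \<open>1\<close> leaves a convergent
  geometric series in \<open>j\<close>, so that the cover costs at most a constant times the \<open>q\<close>-th term.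

  Divergence. All factors are at most \<open>1 / 2\<close>, so it is enough that one coordinate is approximated to
  within \<open>\<psi> q / q\<close>. Integrating over the other coordinates reduces the claim to the line and the gauge
  \<open>g\<close>. There, Dirichlet's theorem and a choice of \<open>q\<close> in a residue class show that the points
  \<open>(p + \<theta>) / q\<close> with \<open>q\<close> between \<open>2 ^ n\<close> and \<open>2 ^ (n + 1)\<close> come within a constant times \<open>4 ^ - n\<close> of
  most points of a fixed interval. Greedy selection over many levels \<open>n\<close> gives finitely many such
  points around which disjoint intervals of length proportional to \<open>g\<close> fill a fixed proportion of
  the interval; this uses the divergence. Given a cover that is cheap on an interval, one of the
  tiny approximation intervals around the selected points is again met only by a cheap part of
  the cover. Iterating yields a well approximable point outside the cover.
\<close>

section \<open>Shifted fractions near most points\<close>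

text \<open>The bound is the integral of \<open>u powr - \<eta>\<close> over \<open>[0, n]\<close>;
  the induction compares increments by Bernoulli's inequality instead of integrating.\<close>

lemma sum_powr_le:
  fixes \<eta> :: real
  assumes "0 \<le> \<eta>" "\<eta> < 1"
  shows "(\<Sum>m=1..n. real m powr - \<eta>) \<le> real n powr (1 - \<eta>) / (1 - \<eta>)"
proof (induction n)
  case 0
  then show ?case by simp
next
  case (Suc n)
  have "real n powr (1 - \<eta>) + (1 - \<eta>) * real (Suc n) powr - \<eta> \<le> real (Suc n) powr (1 - \<eta>)"
  proof (cases "n = 0")
    case True
    then show ?thesis using assms by simp
  next
    case False
    define u where "u = real (Suc n)"
    have u: "u > 1" "real n = u - 1" using False by (auto simp: u_def)
    \<comment> \<open>Weighted AM-GM for \<open>(u - 1) / u\<close> and \<open>1\<close>, that is,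
      \<open>(1 - 1 / u) powr (1 - \<eta>) \<le> 1 - (1 - \<eta>) / u\<close>.\<close>
    have "((u - 1) / u) powr (1 - \<eta>) * 1 powr \<eta> \<le> (1 - \<eta>) * ((u - 1) / u) + \<eta> * 1"
      using assms u by (intro Youngs_inequality_0) auto
    also have "\<dots> = 1 - (1 - \<eta>) / u" using u by (simp add: field_simps)
    finally have "(u - 1) powr (1 - \<eta>) \<le> (1 - (1 - \<eta>) / u) * u powr (1 - \<eta>)"
      using u by (simp add: powr_divide field_simps)
    also have "\<dots> = u powr (1 - \<eta>) - (1 - \<eta>) * u powr - \<eta>"
      using u powr_add[of u "-\<eta>" 1] by (simp add: field_simps)
    finally show ?thesis by (simp add: u(2) u_def[symmetric] del: of_nat_Suc)
  qed
  then have "real n powr (1 - \<eta>) / (1 - \<eta>) + real (Suc n) powr - \<eta> \<le> real (Suc n) powr (1 - \<eta>) / (1 - \<eta>)"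
    using assms by (simp add: divide_simps mult.commute del: of_nat_Suc)
  with Suc.IH show ?case by (simp del: of_nat_Suc)
qed

text \<open>The hypothesis \<open>a \<le> b + 1\<close> keeps the bound nonnegative when the range
  of integers is empty.\<close>

lemma card_int_interval_le:
  fixes a b :: real
  assumes "a \<le> b + 1"
  shows "real (card {\<lceil>a\<rceil>..\<lfloor>b\<rfloor>}) \<le> b - a + 1"
proof (cases "\<lceil>a\<rceil> \<le> \<lfloor>b\<rfloor>")
  case True
  then have "real (card {\<lceil>a\<rceil>..\<lfloor>b\<rfloor>}) = of_int \<lfloor>b\<rfloor> - of_int \<lceil>a\<rceil> + 1" by simp
  also have "\<dots> \<le> b - a + 1" by (intro add_mono diff_mono) linarith+
  finally show ?thesis .
qed (use assms in simp)

section \<open>Lengths of finite unions of intervals\<close>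

lemma interval_cover_length_le:
  fixes c r :: "'a \<Rightarrow> real"
  assumes "finite Z" "\<And>z. z \<in> Z \<Longrightarrow> 0 \<le> r z" "a \<le> b"
    and sub: "{a..b} \<subseteq> (\<Union>z\<in>Z. {c z - r z..c z + r z})"
  shows "b - a \<le> (\<Sum>z\<in>Z. 2 * r z)"
proof -
  have "b - a = measure lborel {a..b}" using assms by simp
  also have "\<dots> \<le> measure lborel (\<Union>z\<in>Z. {c z - r z..c z + r z})"
    using assms(1) sub
    by (intro measure_mono_fmeasurable fmeasurable_compact compact_UN) auto
  also have "\<dots> \<le> (\<Sum>z\<in>Z. measure lborel {c z - r z..c z + r z})"
    using assms(1) by (intro measure_UNION_le) auto
  also have "\<dots> = (\<Sum>z\<in>Z. 2 * r z)"
    using assms(2) by (intro sum.cong) auto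
  finally show ?thesis .
qed

text \<open>Open intervals of radii \<open>r z\<close> are disjoint even if the separation is
  attained, so their lengths add up to at most the length of \<open>[y - R, y + R]\<close>.\<close>

lemma disjoint_intervals_length_le:
  fixes c r :: "'a \<Rightarrow> real"
  assumes "finite Z" "\<And>z. z \<in> Z \<Longrightarrow> 0 \<le> r z" "0 \<le> R"
    and sub: "\<And>z. z \<in> Z \<Longrightarrow> \<bar>c z - y\<bar> + r z \<le> R"
    and sep: "\<And>z w. z \<in> Z \<Longrightarrow> w \<in> Z \<Longrightarrow> z \<noteq> w \<Longrightarrow> r z + r w \<le> \<bar>c z - c w\<bar>"
  shows "(\<Sum>z\<in>Z. r z) \<le> R"
proof -
  have "(\<Sum>z\<in>Z. 2 * r z) = (\<Sum>z\<in>Z. measure lborel {c z - r z<..<c z + r z})"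
    using assms(2) by (intro sum.cong) auto
  also have "\<dots> = measure lborel (\<Union>z\<in>Z. {c z - r z<..<c z + r z})"
  proof (rule measure_finite_Union[symmetric])
    show "disjoint_family_on (\<lambda>z. {c z - r z<..<c z + r z}) Z"
      unfolding disjoint_family_on_def
    proof (intro ballI impI)
      fix z w assume "z \<in> Z" "w \<in> Z" "z \<noteq> w"
      from sep[OF this] show "{c z - r z<..<c z + r z} \<inter> {c w - r w<..<c w + r w} = {}"
        by (auto simp: abs_if split: if_splits)
    qed
  next
    fix z assume "z \<in> Z"
    then show "emeasure lborel {c z - r z<..<c z + r z} \<noteq> \<infinity>" using assms(2) by simp
  qed (use assms(1) in auto)
  also have "\<dots> \<le> measure lborel {y - R..y + R}"
  proof (rule measure_mono_fmeasurable)
    show "(\<Union>z\<in>Z. {c z - r z<..<c z + r z}) \<subseteq> {y - R..y + R}"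
    proof
      fix u assume "u \<in> (\<Union>z\<in>Z. {c z - r z<..<c z + r z})"
      then obtain z where "z \<in> Z" "u \<in> {c z - r z<..<c z + r z}" by auto
      with sub[of z] show "u \<in> {y - R..y + R}" by auto
    qed
  qed (use assms(1) in \<open>auto intro: fmeasurable_compact sets.finite_UN\<close>)
  also have "\<dots> = 2 * R" using assms(3) by simp
  finally show ?thesis by (simp add: sum_distrib_left[symmetric])
qed

text \<open>With \<open>P\<close> the integer nearest to \<open>q\<^sub>0 * \<theta>\<close>, choose
  \<open>q\<close> so that \<open>q * p\<^sub>0\<close> is congruent to \<open>P\<close> modulo
  \<open>q\<^sub>0\<close>, say \<open>q * p\<^sub>0 - P = q\<^sub>0 * w\<close>. Then
  \<open>q\<^sub>0 * (q * x - \<theta> - w)\<close> splits into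
  \<open>q * (q\<^sub>0 * x - p\<^sub>0)\<close> and \<open>P - q\<^sub>0 * \<theta>\<close>, of
  size at most \<open>2\<close> and \<open>1 / 2\<close>.\<close>

lemma inhomogeneous_approx_from_coprime:
  fixes x \<theta> :: real and p\<^sub>0 q\<^sub>0 Q :: int
  assumes cop: "coprime p\<^sub>0 q\<^sub>0" and q0: "0 < q\<^sub>0" "q\<^sub>0 \<le> Q"
    and appr: "\<bar>of_int q\<^sub>0 * x - of_int p\<^sub>0\<bar> < 1 / of_int Q"
  shows "\<exists>q p. Q \<le> q \<and> q < 2 * Q \<and> \<bar>of_int q * x - \<theta> - of_int p\<bar> \<le> 5 / (2 * of_int q\<^sub>0)"
proof -
  obtain u v where uv: "u * p\<^sub>0 + v * q\<^sub>0 = 1"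
    using bezout_int[of p\<^sub>0 q\<^sub>0] cop by auto
  define P where "P = round (of_int q\<^sub>0 * \<theta>)"
  \<comment> \<open>The least integer from \<open>Q\<close> on congruent to \<open>u * P\<close>,
    where \<open>u\<close> inverts \<open>p\<^sub>0\<close> modulo \<open>q\<^sub>0\<close>; it is
    below \<open>Q + q\<^sub>0 \<le> 2 * Q\<close>.\<close>
  define q where "q = Q + (u * P - Q) mod q\<^sub>0"
  have q: "Q \<le> q" "q < 2 * Q"
    using q0 pos_mod_bound[of q\<^sub>0 "u * P - Q"] pos_mod_sign[of q\<^sub>0 "u * P - Q"] unfolding q_def by linarith+
  have "q\<^sub>0 dvd q * p\<^sub>0 - P"
  proof -
    have "q = u * P - q\<^sub>0 * ((u * P - Q) div q\<^sub>0)"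
      unfolding q_def by (simp add: minus_mult_div_eq_mod[symmetric])
    moreover have "P = u * p\<^sub>0 * P + v * q\<^sub>0 * P"
      using uv by (metis distrib_right mult_1)
    ultimately have "q * p\<^sub>0 - P = q\<^sub>0 * (- p\<^sub>0 * ((u * P - Q) div q\<^sub>0) - v * P)"
      by algebra
    then show ?thesis by simp
  qed
  then obtain w where w: "q * p\<^sub>0 - P = q\<^sub>0 * w" by auto
  then have w': "of_int q * of_int p\<^sub>0 - of_int P = (of_int q\<^sub>0 * of_int w :: real)"
    by (metis of_int_diff of_int_mult)
  have "of_int q\<^sub>0 * (of_int q * x - \<theta> - of_int w)
      = of_int q * (of_int q\<^sub>0 * x - of_int p\<^sub>0) + (of_int P - of_int q\<^sub>0 * \<theta>)"
    using w' by (simp add: algebra_simps)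
  also have "\<bar>\<dots>\<bar> \<le> of_int q * \<bar>of_int q\<^sub>0 * x - of_int p\<^sub>0\<bar> + \<bar>of_int P - of_int q\<^sub>0 * \<theta>\<bar>"
    using q q0 by (intro order.trans[OF abs_triangle_ineq]) (simp add: abs_mult)
  also have "\<dots> \<le> (2 * of_int Q) * (1 / of_int Q) + 1 / 2"
  proof (rule add_mono)
    show "\<bar>of_int P - of_int q\<^sub>0 * \<theta>\<bar> \<le> 1 / 2"
      unfolding P_def by (rule of_int_round_abs_le)
    show "of_int q * \<bar>of_int q\<^sub>0 * x - of_int p\<^sub>0\<bar> \<le> (2 * of_int Q) * (1 / of_int Q)"
    proof (rule mult_mono)
      show "real_of_int q \<le> 2 * of_int Q"
        using q(2) by linarith
    qed (use appr q0 in auto)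
  qed
  also have "\<dots> = 5 / 2" using q0 by simp
  finally have "of_int q\<^sub>0 * \<bar>of_int q * x - \<theta> - of_int w\<bar> \<le> 5 / 2"
    using q0 by (simp only: abs_mult of_int_abs[symmetric] abs_of_pos)
  then have "\<bar>of_int q * x - \<theta> - of_int w\<bar> \<le> 5 / (2 * of_int q\<^sub>0)"
    using q0 by (simp add: le_divide_eq mult.commute mult.left_commute)
  with q show ?thesis by blast
qed

text \<open>The left side bounds the total length of the intervals of radius
  \<open>1 / (q * Q)\<close> around fractions of denominator \<open>q < Q / 8\<close> near an
  interval of length \<open>l\<close>. There are at most \<open>Q / 8\<close> denominators, each
  contributing \<open>2 * l / Q\<close> to the main term.\<close>

lemma small_denominators_length:
  fixes l :: real and Q :: nat
  assumes "0 \<le> l" "Q \<ge> 1"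
  shows "(\<Sum>q\<in>{q. 1 \<le> q \<and> 8 * q < Q}. (real q * l + 3) * (2 / (real q * real Q))) \<le> l / 4 + 12 / sqrt (real Q)"
proof -
  define S where "S = {q. 1 \<le> q \<and> 8 * q < Q}"
  have S: "S \<subseteq> {1..Q div 8}" "S \<subseteq> {1..Q}" by (auto simp: S_def)
  have fin: "finite S" using S(1) finite_subset by blast
  have card: "8 * real (card S) \<le> real Q"
  proof -
    have "card S \<le> Q div 8" using card_mono[OF _ S(1)] by simp
    then have "8 * card S \<le> Q" by linarith
    then show ?thesis by (metis of_nat_le_iff of_nat_mult of_nat_numeral)
  qed
  have "(\<Sum>q\<in>S. (real q * l + 3) * (2 / (real q * real Q))) = (\<Sum>q\<in>S. 2 * l / real Q + 6 / real Q * (1 / real q))"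
    by (intro sum.cong) (auto simp: S_def field_simps)
  also have "\<dots> = real (card S) * (2 * l / real Q) + 6 / real Q * (\<Sum>q\<in>S. 1 / real q)"
    by (simp add: sum.distrib sum_distrib_left)
  also have "\<dots> \<le> l / 4 + 6 / real Q * (2 * sqrt (real Q))"
  proof (intro add_mono mult_left_mono)
    have "8 * real (card S) * l \<le> real Q * l" using card assms by (intro mult_right_mono)
    then show "real (card S) * (2 * l / real Q) \<le> l / 4" using assms by (simp add: field_simps)
    have "(\<Sum>q\<in>S. 1 / real q) \<le> (\<Sum>q=1..Q. 1 / real q)"
      using S by (intro sum_mono2) auto
    \<comment> \<open>A crude bound for the harmonic sum, good enough because it is divided by
      \<open>Q\<close>.\<close>
    also have "\<dots> \<le> (\<Sum>q=1..Q. real q powr - (1/2))"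
    proof (rule sum_mono)
      fix q assume "q \<in> {1..Q}"
      then have "real q powr - 1 \<le> real q powr - (1/2)" by (intro powr_mono) auto
      with \<open>q \<in> {1..Q}\<close> show "1 / real q \<le> real q powr - (1/2)" by (simp add: powr_minus_divide)
    qed
    also have "\<dots> \<le> 2 * sqrt (real Q)"
      using sum_powr_le[of "1/2" Q] by (simp add: powr_half_sqrt)
    finally show "(\<Sum>q\<in>S. 1 / real q) \<le> 2 * sqrt (real Q)" .
  qed auto
  also have "6 / real Q * (2 * sqrt (real Q)) = 12 / sqrt (real Q)"
  proof -
    have "sqrt (real Q) > 0" using assms(2) by simp
    then show ?thesis by (simp add: field_simps)
  qed
  finally show ?thesis by (simp add: S_def)
qed

text \<open>A real \<open>x\<close> whose Dirichlet denominator at level \<open>Q\<close> is at least \<open>Q / 8\<close> is also well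
  approximated by the shifted fractions; all other \<open>x\<close> lie in a union of short intervals.\<close>

lemma shifted_fractions_ubiquity:
  fixes a b \<theta> :: real
  assumes "a < b"
  shows "\<exists>Q\<^sub>0\<ge>1. \<forall>Q\<ge>Q\<^sub>0. \<forall>(Z :: 'z set) c r. finite Z \<longrightarrow> (\<forall>z\<in>Z. 0 \<le> r z) \<longrightarrow>
           (\<Sum>z\<in>Z. 2 * r z) \<le> (b - a) / 2 \<longrightarrow>
           (\<exists>x\<in>{a..b}. (\<forall>z\<in>Z. r z < \<bar>x - c z\<bar>) \<and>
              (\<exists>(q::nat) (p::int). Q \<le> q \<and> q < 2 * Q \<and>
                  \<bar>x - (of_int p + \<theta>) / real q\<bar> \<le> 20 / real Q ^ 2))"
proof -
  obtain Q\<^sub>0 :: nat where Q0: "real Q\<^sub>0 > (48 / (b - a)) ^ 2 + 1"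
    using reals_Archimedean2 by blast
  have "Q\<^sub>0 \<ge> 1" using Q0 by (smt (verit) of_nat_0 less_one not_less zero_le_power2)
  moreover have "\<exists>x\<in>{a..b}. (\<forall>z\<in>Z. r z < \<bar>x - c z\<bar>) \<and>
              (\<exists>(q::nat) (p::int). Q \<le> q \<and> q < 2 * Q \<and>
                  \<bar>x - (of_int p + \<theta>) / real q\<bar> \<le> 20 / real Q ^ 2)"
    if Q: "Q \<ge> Q\<^sub>0" and Z: "finite Z" "\<forall>z\<in>Z. 0 \<le> r z" "(\<Sum>z\<in>Z. 2 * r z) \<le> (b - a) / 2"
    for Q and Z :: "'z set" and c r
  proof -
    have Q1: "Q \<ge> 1" using Q \<open>Q\<^sub>0 \<ge> 1\<close> by simp
    have "(48 / (b - a)) ^ 2 < real Q" using Q0 Q by (smt (verit) of_nat_le_iff)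
    then have "48 / (b - a) < sqrt (real Q)"
      by (rule real_less_rsqrt)
    then have sq: "12 / sqrt (real Q) < (b - a) / 4" using assms Q1 by (simp add: field_simps)
    define S where "S = {q. 1 \<le> q \<and> 8 * q < Q}"
    have finS: "finite S" by (rule finite_subset[of _ "{..Q}"]) (auto simp: S_def)
    define Y where "Y = Sigma S (\<lambda>q. {\<lceil>real q * a - 1\<rceil>..\<lfloor>real q * b + 1\<rfloor>})"
    have finY: "finite Y" using finS by (auto simp: Y_def)
    define c' where "c' = case_sum c (\<lambda>(q::nat, p). real_of_int p / real q)"
    define r' where "r' = case_sum r (\<lambda>(q::nat, p::int). 1 / (real q * real Q))"
    have "(\<Sum>z\<in>Y. 2 * (case z of (q, p) \<Rightarrow> 1 / (real q * real Q)))
        = (\<Sum>q\<in>S. \<Sum>p\<in>{\<lceil>real q * a - 1\<rceil>..\<lfloor>real q * b + 1\<rfloor>}. 2 / (real q * real Q))"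
      unfolding Y_def using finS by (subst sum.Sigma) (auto intro!: sum.cong)
    also have "\<dots> \<le> (\<Sum>q\<in>S. (real q * (b - a) + 3) * (2 / (real q * real Q)))"
    proof (rule sum_mono)
      fix q assume "q \<in> S"
      have "real q * a \<le> real q * b" using assms by (intro mult_left_mono) auto
      then have "real (card {\<lceil>real q * a - 1\<rceil>..\<lfloor>real q * b + 1\<rfloor>}) \<le> real q * (b - a) + 3"
        using card_int_interval_le[of "real q * a - 1" "real q * b + 1"] by (simp add: algebra_simps)
      then show "(\<Sum>p\<in>{\<lceil>real q * a - 1\<rceil>..\<lfloor>real q * b + 1\<rfloor>}. 2 / (real q * real Q))
          \<le> (real q * (b - a) + 3) * (2 / (real q * real Q))"
        by (subst sum_constant) (intro mult_right_mono, auto)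
    qed
    also have "\<dots> \<le> (b - a) / 4 + 12 / sqrt (real Q)"
      unfolding S_def using assms Q1 by (intro small_denominators_length) auto
    finally have Ysum: "(\<Sum>z\<in>Y. 2 * (case z of (q, p) \<Rightarrow> 1 / (real q * real Q))) < (b - a) / 2"
      using sq by linarith
    \<comment> \<open>The given intervals fill at most half of \<open>[a, b]\<close> and those
      around small denominators less than half, so some point escapes both.\<close>
    have "\<not> {a..b} \<subseteq> (\<Union>z\<in>Z <+> Y. {c' z - r' z..c' z + r' z})"
    proof
      assume "{a..b} \<subseteq> (\<Union>z\<in>Z <+> Y. {c' z - r' z..c' z + r' z})"
      then have "b - a \<le> (\<Sum>z\<in>Z <+> Y. 2 * r' z)"
        using Z finY assms by (intro interval_cover_length_le) (auto simp: r'_def)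
      also have "\<dots> = (\<Sum>z\<in>Z. 2 * r z) + (\<Sum>z\<in>Y. 2 * (case z of (q, p) \<Rightarrow> 1 / (real q * real Q)))"
        using Z finY by (subst sum.Plus) (auto simp: r'_def)
      also have "\<dots> < b - a" using Z(3) Ysum by simp
      finally show False by simp
    qed
    then obtain x where x: "x \<in> {a..b}" "\<And>z. z \<in> Z <+> Y \<Longrightarrow> \<not> (c' z - r' z \<le> x \<and> x \<le> c' z + r' z)"
      unfolding subset_iff UN_iff Ball_def atLeastAtMost_iff by blast
    have xZ: "\<forall>z\<in>Z. r z < \<bar>x - c z\<bar>"
    proof
      fix z assume "z \<in> Z"
      then have "Inl z \<in> Z <+> Y" by (rule InlI)
      from x(2)[OF this] show "r z < \<bar>x - c z\<bar>" by (auto simp: c'_def r'_def)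
    qed
    obtain h k where hk: "coprime h k" "0 < k" "k \<le> int Q" "\<bar>of_int k * x - of_int h\<bar> < 1 / real Q"
      using Dirichlet_approx_coprime[of Q x] Q1 by auto
    define n where "n = nat k"
    have n: "k = int n" "n \<ge> 1" using hk by (auto simp: n_def)
    \<comment> \<open>Otherwise \<open>h / n\<close> is indexed by \<open>Y\<close>, and Dirichlet's
      bound puts \<open>x\<close> into an interval that it avoids.\<close>
    have "8 * n \<ge> Q"
    proof (rule ccontr)
      assume "\<not> Q \<le> 8 * n"
      then have nS: "n \<in> S" using n by (auto simp: S_def)
      have "1 / real Q \<le> 1" using Q1 by simp
      then have nh: "\<bar>real n * x - of_int h\<bar> \<le> 1" using hk(4) n by simp
      have "real n * a \<le> real n * x" "real n * x \<le> real n * b"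
        using x(1) by (auto intro: mult_left_mono)
      then have "real n * a - 1 \<le> of_int h" "of_int h \<le> real n * b + 1" using nh by linarith+
      then have "(n, h) \<in> Y"
        unfolding Y_def using nS by (intro SigmaI) (simp_all only: atLeastAtMost_iff ceiling_le_iff le_floor_iff)
      then have "\<not> (h / n - 1 / (real n * real Q) \<le> x \<and> x \<le> h / n + 1 / (real n * real Q))"
        using x(2)[of "Inr (n, h)"] by (auto simp: c'_def r'_def)
      moreover have "\<bar>x - h / n\<bar> \<le> 1 / (real n * real Q)"
      proof -
        have "\<bar>x - h / n\<bar> = \<bar>real n * x - h\<bar> / real n"
          using n by (simp add: field_simps abs_if)
        also have "\<dots> \<le> (1 / real Q) / real n" using hk(4) n by (intro divide_right_mono) auto
        finally show ?thesis by (simp add: field_simps)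
      qed
      ultimately show False by (auto simp: abs_le_iff)
    qed
    obtain q p where qp: "int Q \<le> q" "q < 2 * int Q" "\<bar>of_int q * x - \<theta> - of_int p\<bar> \<le> 5 / (2 * of_int k)"
      using inhomogeneous_approx_from_coprime[of h k "int Q" x \<theta>] hk by auto
    define m where "m = nat q"
    have m: "q = int m" "Q \<le> m" "m < 2 * Q" using qp Q1 by (auto simp: m_def)
    have "\<bar>x - (of_int p + \<theta>) / real m\<bar> = \<bar>real m * x - \<theta> - of_int p\<bar> / real m"
    proof -
      have "x - (of_int p + \<theta>) / real m = (real m * x - \<theta> - of_int p) / real m"
        using m Q1 by (simp add: field_simps)
      then show ?thesis by simp
    qed
    also have "\<dots> \<le> (5 / (2 * real n)) / real Q"
      using qp(3) m n Q1 by (intro frac_le) auto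
    also have "\<dots> \<le> (5 / (2 * (real Q / 8))) / real Q"
      using \<open>8 * n \<ge> Q\<close> Q1 n by (intro divide_right_mono divide_left_mono) auto
    also have "\<dots> = 20 / real Q ^ 2" by (simp add: power2_eq_square)
    finally show ?thesis using x(1) xZ m by blast
  qed
  ultimately show ?thesis by blast
qed

text \<open>Points of level \<open>n\<close> are added greedily until the family has about
  \<open>l * 4 ^ n / 336\<close> members or total radius above \<open>l / 16\<close>. Before that,
  the enlarged intervals around the chosen points fill at most half of the middle half of
  \<open>[a, b]\<close>, so ubiquity yields a further point. Each level contributes a fixed multiple
  of \<open>l * 4 ^ n * R n\<close>, and divergence ends the process.\<close>

lemma separated_family:
  fixes a b \<theta> :: real and R :: "nat \<Rightarrow> real"
  assumes ab: "a < b" and R: "\<And>n. 0 < R n" "\<And>n. R n \<le> 1 / 4 ^ n"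
    and div: "\<not> summable (\<lambda>n. 4 ^ n * R n)"
  shows "\<exists>F :: (real \<times> nat) set. finite F \<and>
    (\<forall>u\<in>F. N \<le> snd u \<and> a + R (snd u) \<le> fst u \<and> fst u + R (snd u) \<le> b \<and>
       (\<exists>(q::nat) (p::int). 2 ^ snd u \<le> q \<and> q < 2 * 2 ^ snd u \<and> fst u = (of_int p + \<theta>) / real q)) \<and>
    (\<forall>u\<in>F. \<forall>v\<in>F. u \<noteq> v \<longrightarrow> R (snd u) + R (snd v) \<le> \<bar>fst u - fst v\<bar>) \<and>
    (b - a) / 16 \<le> (\<Sum>u\<in>F. R (snd u))"
proof -
  define l where "l = b - a"
  have l: "l > 0" using ab by (simp add: l_def)
  define valid where "valid = (\<lambda>F :: (real \<times> nat) set. finite F \<and>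
    (\<forall>u\<in>F. N \<le> snd u \<and> a + R (snd u) \<le> fst u \<and> fst u + R (snd u) \<le> b \<and>
       (\<exists>(q::nat) (p::int). 2 ^ snd u \<le> q \<and> q < 2 * 2 ^ snd u \<and> fst u = (of_int p + \<theta>) / real q)) \<and>
    (\<forall>u\<in>F. \<forall>v\<in>F. u \<noteq> v \<longrightarrow> R (snd u) + R (snd v) \<le> \<bar>fst u - fst v\<bar>))"
  define w where "w = (\<lambda>F :: (real \<times> nat) set. \<Sum>u\<in>F. R (snd u))"
  \<comment> \<open>Searching only the middle half leaves room for the new interval inside
    \<open>[a, b]\<close>.\<close>
  have "a + l / 4 < b - l / 4" using l by (simp add: l_def field_simps)
  from shifted_fractions_ubiquity[OF this, of \<theta>, where 'z="real \<times> nat"]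
  obtain Q\<^sub>0 where Q0: "Q\<^sub>0 \<ge> 1" and ubi:
    "\<forall>Q\<ge>Q\<^sub>0. \<forall>(Z :: (real \<times> nat) set) c r. finite Z \<longrightarrow> (\<forall>z\<in>Z. 0 \<le> r z) \<longrightarrow>
       (\<Sum>z\<in>Z. 2 * r z) \<le> (b - l / 4 - (a + l / 4)) / 2 \<longrightarrow>
       (\<exists>x\<in>{a + l / 4..b - l / 4}. (\<forall>z\<in>Z. r z < \<bar>x - c z\<bar>) \<and>
          (\<exists>(q::nat) (p::int). Q \<le> q \<and> q < 2 * Q \<and> \<bar>x - (of_int p + \<theta>) / real q\<bar> \<le> 20 / real Q ^ 2))"
    by (elim exE conjE) (rule that)
  obtain N\<^sub>1 where N1: "N\<^sub>1 \<ge> N" "\<And>n. n \<ge> N\<^sub>1 \<Longrightarrow> 2 ^ n \<ge> Q\<^sub>0" "\<And>n. n \<ge> N\<^sub>1 \<Longrightarrow> l * 4 ^ n \<ge> 1344"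
  proof -
    obtain K where K: "1344 / l < 4 ^ K" using real_arch_pow[of 4 "1344 / l"] by auto
    define N\<^sub>1 where "N\<^sub>1 = N + Q\<^sub>0 + K"
    show ?thesis
    proof (rule that)
      show "N \<le> N\<^sub>1" by (simp add: N\<^sub>1_def)
      fix n assume n: "n \<ge> N\<^sub>1"
      then have "Q\<^sub>0 \<le> n" by (simp add: N\<^sub>1_def)
      also have "n \<le> 2 ^ n" using less_exp[of n] by simp
      finally show "2 ^ n \<ge> Q\<^sub>0" .
      have "(4::real) ^ K \<le> 4 ^ n" using n by (intro power_increasing) (auto simp: N\<^sub>1_def)
      with K have "1344 / l \<le> 4 ^ n" by linarith
      then show "l * 4 ^ n \<ge> 1344" using l by (simp add: field_simps)
    qed
  qed
  have step: "\<exists>x. (x, n) \<notin> F \<and> valid (insert (x, n) F)"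
    if F: "valid F" "w F \<le> l / 16" "real (card F) \<le> l * 4 ^ n / 336" and n: "n \<ge> N\<^sub>1" for F n
  proof -
    have fin: "finite F" using F by (simp add: valid_def)
    have e4: "real (2 ^ n) ^ 2 = 4 ^ n" by (simp add: power2_eq_square flip: power_mult_distrib)
    \<comment> \<open>Besides \<open>R (snd u)\<close>, the radius has room for the new
      \<open>R n\<close> and for the move from \<open>x\<^sub>0\<close> to a fraction within
      \<open>20 / 4 ^ n\<close>.\<close>
    define r where "r = (\<lambda>u :: real \<times> nat. R (snd u) + R n + 20 / 4 ^ n)"
    have "(\<Sum>u\<in>F. 2 * r u) = 2 * w F + 2 * real (card F) * (R n + 20 / 4 ^ n)"
      by (simp add: r_def w_def sum.distrib sum_distrib_left algebra_simps)
    \<comment> \<open>Both summands are \<open>l / 8\<close>, since \<open>336 = 16 * 21\<close> and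
      \<open>1 + 20 = 21\<close>.\<close>
    also have "\<dots> \<le> 2 * (l / 16) + 2 * (l * 4 ^ n / 336) * (1 / 4 ^ n + 20 / 4 ^ n)"
    proof (rule add_mono)
      show "2 * real (card F) * (R n + 20 / 4 ^ n) \<le> 2 * (l * 4 ^ n / 336) * (1 / 4 ^ n + 20 / 4 ^ n)"
        using F(3) R(1)[of n] R(2)[of n] l by (intro mult_mono) auto
    qed (use F(2) in simp)
    also have "\<dots> = l / 4" by (simp add: field_simps)
    also have "\<dots> = (b - l / 4 - (a + l / 4)) / 2" by (simp add: l_def field_simps)
    finally have sum: "(\<Sum>u\<in>F. 2 * r u) \<le> (b - l / 4 - (a + l / 4)) / 2" .
    have rpos: "\<forall>u\<in>F. 0 \<le> r u" using R(1) by (auto simp: r_def intro!: less_imp_le add_pos_pos)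
    from ubi[rule_format, OF N1(2)[OF n] fin, of r fst] rpos sum obtain x\<^sub>0 and q :: nat and p :: int where
      x0: "x\<^sub>0 \<in> {a + l / 4..b - l / 4}" "\<forall>u\<in>F. r u < \<bar>x\<^sub>0 - fst u\<bar>"
      "2 ^ n \<le> q" "q < 2 * 2 ^ n" "\<bar>x\<^sub>0 - (of_int p + \<theta>) / real q\<bar> \<le> 20 / real (2 ^ n) ^ 2"
      by blast
    define x where "x = (of_int p + \<theta>) / real q"
    have xx: "\<bar>x\<^sub>0 - x\<bar> \<le> 20 / 4 ^ n" using x0(5) e4 by (simp add: x_def)
    have sep: "R (snd u) + R n < \<bar>x - fst u\<bar>" if "u \<in> F" for u
    proof -
      have "R (snd u) + R n + 20 / 4 ^ n < \<bar>x\<^sub>0 - fst u\<bar>" using x0(2) that by (auto simp: r_def)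
      with xx show ?thesis by linarith
    qed
    have notin: "(x, n) \<notin> F" using sep[of "(x, n)"] R(1)[of n] by auto
    have "84 \<le> l * 4 ^ n" using N1(3)[OF n] by simp
    then have "21 / 4 ^ n \<le> l / 4" by (simp add: field_simps)
    then have "20 / 4 ^ n + R n \<le> l / 4" using R(2)[of n] by (simp add: field_simps)
    then have "a + R n \<le> x" "x + R n \<le> b" using x0(1) xx by (auto simp: abs_le_iff)
    moreover have "N \<le> n" using N1(1) n by simp
    ultimately have "valid (insert (x, n) F)"
      using F(1) sep x0(3,4) unfolding valid_def
      by (auto simp: x_def abs_minus_commute add.commute intro!: less_imp_le)
    with notin show ?thesis by blast
  qed
  have level: "\<exists>F'. valid F' \<and> (l / 16 < w F' \<or> (card F' = card F + j \<and> w F' = w F + real j * R n))"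
    if F: "valid F" and n: "n \<ge> N\<^sub>1" and c: "real (card F + j) \<le> l * 4 ^ n / 336" for F n j
    using c
  proof (induction j)
    case 0
    then show ?case using F by auto
  next
    case (Suc j)
    then obtain F' where F': "valid F'" "l / 16 < w F' \<or> (card F' = card F + j \<and> w F' = w F + real j * R n)"
      by auto
    show ?case
    proof (cases "l / 16 < w F'")
      case True
      then show ?thesis using F' by blast
    next
      case False
      then have F'': "card F' = card F + j" "w F' = w F + real j * R n" using F' by auto
      with step[OF F'(1), of n] False n Suc.prems obtain x where
        x: "(x, n) \<notin> F'" "valid (insert (x, n) F')" by auto
      have "finite F'" using F' by (simp add: valid_def)
      then have "card (insert (x, n) F') = card F + Suc j"
        "w (insert (x, n) F') = w F + real (Suc j) * R n"
        using x(1) F'' by (auto simp: w_def algebra_simps)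
      with x(2) show ?thesis by blast
    qed
  qed
  have levels: "\<exists>F. valid F \<and> (l / 16 < w F \<or> (real (card F) \<le> l * 4 ^ (N\<^sub>1 + M) / 336 / 4 \<and>
      (\<Sum>m<M. l / 672 * (4 ^ (m + N\<^sub>1) * R (m + N\<^sub>1))) \<le> w F))" for M
  proof (induction M)
    case 0
    show ?case using l by (intro exI[of _ "{}"]) (auto simp: valid_def w_def)
  next
    case (Suc M)
    then obtain F where F: "valid F" "l / 16 < w F \<or> (real (card F) \<le> l * 4 ^ (N\<^sub>1 + M) / 336 / 4 \<and>
      (\<Sum>m<M. l / 672 * (4 ^ (m + N\<^sub>1) * R (m + N\<^sub>1))) \<le> w F)" by auto
    show ?case
    proof (cases "l / 16 < w F")
      case True
      then show ?thesis using F by blast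
    next
      case False
      with F have F2: "real (card F) \<le> l * 4 ^ (N\<^sub>1 + M) / 336 / 4"
        "(\<Sum>m<M. l / 672 * (4 ^ (m + N\<^sub>1) * R (m + N\<^sub>1))) \<le> w F" by auto
      define n where "n = N\<^sub>1 + M"
      define K where "K = l * 4 ^ n / 336"
      have K: "K \<ge> 4" using N1(3)[of n] by (simp add: K_def n_def)
      define k where "k = nat \<lfloor>K\<rfloor>"
      have k: "real k \<le> K" "K < real k + 1" using K by (auto simp: k_def of_nat_nat)
      have cF: "real (card F) \<le> K / 4" using F2 by (simp add: K_def n_def)
      then have "real (card F) \<le> real k" using k K by linarith
      then obtain j where j: "k = card F + j" by (metis of_nat_le_iff le_Suc_ex)
      \<comment> \<open>Earlier levels used at most a quarter of the quota \<open>K\<close>, and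
        \<open>K \<ge> 4\<close> absorbs the rounding down to \<open>k\<close>.\<close>
      have jK: "real j \<ge> K / 2" using cF k K j by simp
      have "real (card F + j) \<le> l * 4 ^ n / 336" using k j by (simp add: K_def)
      from level[OF F(1) _ this] obtain F' where F': "valid F'"
        "l / 16 < w F' \<or> (card F' = card F + j \<and> w F' = w F + real j * R n)" by (auto simp: n_def)
      show ?thesis
      proof (cases "l / 16 < w F'")
        case True
        then show ?thesis using F' by blast
      next
        case False
        with F' have F'': "card F' = k" "w F' = w F + real j * R n" by (auto simp: j)
        have "real (card F') \<le> l * 4 ^ (N\<^sub>1 + Suc M) / 336 / 4"
          using F''(1) k(1) by (simp add: K_def n_def)
        moreover have "K / 2 * R n \<le> real j * R n" using jK R(1)[of n] by (intro mult_right_mono) auto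
        then have "(\<Sum>m<Suc M. l / 672 * (4 ^ (m + N\<^sub>1) * R (m + N\<^sub>1))) \<le> w F'"
          using F2(2) F''(2) by (simp add: K_def n_def add.commute)
        ultimately show ?thesis using F' by blast
      qed
    qed
  qed
  have "\<exists>M. l / 16 < (\<Sum>m<M. l / 672 * (4 ^ (m + N\<^sub>1) * R (m + N\<^sub>1)))"
  proof (rule ccontr)
    assume "\<nexists>M. l / 16 < (\<Sum>m<M. l / 672 * (4 ^ (m + N\<^sub>1) * R (m + N\<^sub>1)))"
    then have "\<And>M. (\<Sum>m<M. l / 672 * (4 ^ (m + N\<^sub>1) * R (m + N\<^sub>1))) \<le> l / 16" by (meson not_le)
    then have "summable (\<lambda>m. l / 672 * (4 ^ (m + N\<^sub>1) * R (m + N\<^sub>1)))"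
      using l R(1) by (intro summableI_nonneg_bounded[where x = "l / 16"]) (auto intro!: mult_nonneg_nonneg less_imp_le)
    then have "summable (\<lambda>m. 4 ^ (m + N\<^sub>1) * R (m + N\<^sub>1))" using l by (subst (asm) summable_cmult_iff) auto
    then show False using div summable_iff_shift[of "\<lambda>n. 4 ^ n * R n" N\<^sub>1] by simp
  qed
  then obtain M where "l / 16 < (\<Sum>m<M. l / 672 * (4 ^ (m + N\<^sub>1) * R (m + N\<^sub>1)))" ..
  with levels[of M] obtain F where "valid F" "l / 16 < w F" by fastforce
  then show ?thesis unfolding valid_def w_def l_def by (intro exI[of _ F]) auto
qed

section \<open>Points missed by cheap covers\<close>

text \<open>If the capped series converged, its terms would tend to \<open>0\<close>, so the cap
  would eventually be inactive.\<close>

lemma not_summable_min: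
  fixes x :: "nat \<Rightarrow> real"
  assumes "\<not> summable x" "h > 0"
  shows "\<not> summable (\<lambda>n. min (h * x n) 1)"
proof
  assume S: "summable (\<lambda>n. min (h * x n) 1)"
  then have "(\<lambda>n. min (h * x n) 1) \<longlonglongrightarrow> 0" by (rule summable_LIMSEQ_zero)
  then have "\<forall>\<^sub>F n in sequentially. min (h * x n) 1 < 1" by (rule order_tendstoD) simp
  then have "\<forall>\<^sub>F n in sequentially. min (h * x n) 1 = h * x n" by eventually_elim auto
  with S have "summable (\<lambda>n. h * x n)" by (subst (asm) summable_cong) auto
  then show False using assms by (subst (asm) summable_cmult_iff) auto
qed

text \<open>In the application \<open>g x = x powr (1 - d) * f x\<close> and
  \<open>t = s - (d - 1)\<close>, so that the analysis on the line no longer mentions the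
  dimension.\<close>

locale gauge =
  fixes g :: "real \<Rightarrow> real" and t C :: real
  assumes t: "0 < t" "t < 1" and C: "1 \<le> C"
    and pos: "0 < x \<Longrightarrow> 0 < g x"
    and mono: "0 < x \<Longrightarrow> x \<le> y \<Longrightarrow> g x \<le> g y"
    and growth: "0 < x \<Longrightarrow> x \<le> y \<Longrightarrow> g y \<le> C * (y / x) powr t * g x"
begin

section \<open>Gauges of growth exponent below one\<close>

lemma linear_growth:
  assumes "0 < x" "x \<le> y"
  shows "x * g y \<le> C * y * g x"
proof -
  have "(y / x) powr t \<le> (y / x) powr 1" using t assms by (intro powr_mono) auto
  then have "C * (y / x) powr t * g x \<le> C * (y / x) * g x"
    using assms C pos[of x] by (intro mult_right_mono mult_left_mono) auto
  with growth[OF assms] have "g y \<le> C * (y / x) * g x" by linarith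
  then show ?thesis using assms by (simp add: field_simps)
qed

lemma lower_bound:
  assumes "0 < x" "x \<le> 1"
  shows "g 1 * x powr t \<le> C * g x"
proof -
  have "g 1 \<le> C * (1 / x) powr t * g x" using growth[of x 1] assms by simp
  then show ?thesis using assms by (simp add: powr_divide field_simps)
qed

text \<open>On \<open>(0, 1]\<close> the gauge dominates a multiple of \<open>x powr t\<close> with
  \<open>t < 1\<close>. The threshold \<open>d\<close> solves \<open>x powr (1 - t) = K\<close>,
  capped at \<open>1\<close>.\<close>

lemma small_compared_to_gauge:
  assumes "e > 0"
  shows "\<exists>d>0. \<forall>x. 0 < x \<and> x \<le> d \<longrightarrow> x \<le> e * g x"
proof -
  define K where "K = e * g 1 / C"
  have K: "K > 0" using assms C pos[of 1] by (simp add: K_def)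
  define d where "d = min 1 (K powr (1 / (1 - t)))"
  have "x \<le> e * g x" if x: "0 < x" "x \<le> d" for x
  proof -
    have "x powr (1 - t) \<le> (K powr (1 / (1 - t))) powr (1 - t)"
      using x t by (intro powr_mono2) (auto simp: d_def)
    also have "\<dots> = K" using K t by (simp add: powr_powr)
    finally have "x powr t * x powr (1 - t) \<le> x powr t * K" by (intro mult_left_mono) auto
    then have "x \<le> x powr t * K" using x by (simp flip: powr_add)
    also have "\<dots> \<le> e * g x"
    proof -
      have "g 1 * x powr t \<le> C * g x" using x by (intro lower_bound) (auto simp: d_def)
      then have "e * (g 1 * x powr t) \<le> e * (C * g x)" using assms by simp
      then show ?thesis using C by (simp add: K_def field_simps)
    qed
    finally show ?thesis .
  qed
  moreover have "d > 0" using K by (auto simp: d_def)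
  ultimately show ?thesis by blast
qed

text \<open>The index set \<open>S\<close> serves the slicing argument, where it selects the
  covering sets that may meet a given line. Values in \<open>ennreal\<close> make the sum meaningful
  without a summability condition.\<close>

definition hit_cost :: "(nat \<Rightarrow> real) \<Rightarrow> (nat \<Rightarrow> real) \<Rightarrow> nat set \<Rightarrow> real \<Rightarrow> real \<Rightarrow> ennreal" where
  "hit_cost c r S a b = (\<Sum>i. if i \<in> S \<and> c i - r i \<le> b \<and> a \<le> c i + r i then ennreal (g (r i)) else 0)"

text \<open>If the intervals \<open>[c i - r i, c i + r i]\<close> meeting \<open>[a, b]\<close> are cheap compared with \<open>g (b - a)\<close>,
  the same holds for one of the small intervals produced by \<open>separated_family\<close>: an interval
  meeting two of them is at least as long as the separation, and the linear growth bound makes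
  these few, while an interval meeting only one of them is charged only once.\<close>

lemma descent:
  fixes \<Delta> c r :: "nat \<Rightarrow> real" and \<theta> :: real
  assumes ab: "a < b" and r: "\<And>i. 0 < r i"
    and \<Delta>: "\<And>n. 0 < \<Delta> n" "\<And>n. 2 * \<Delta> n \<le> 1 / 4 ^ n" "\<not> summable (\<lambda>n. 4 ^ n * g (\<Delta> n))"
    and cost: "hit_cost c r S a b < ennreal (g (b - a) / (224 * C))"
  shows "\<exists>n x. N \<le> n \<and> (\<exists>(q::nat) (p::int). 2 ^ n \<le> q \<and> q < 2 * 2 ^ n \<and> x = (of_int p + \<theta>) / real q) \<and>
    a \<le> x - \<Delta> n \<and> x + \<Delta> n \<le> b \<and>
    hit_cost c r S (x - \<Delta> n) (x + \<Delta> n) < ennreal (g (2 * \<Delta> n) / (224 * C))"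
proof -
  define l where "l = b - a"
  have l: "l > 0" using ab by (simp add: l_def)
  have gl: "g l > 0" using pos l by simp
  \<comment> \<open>Chosen so that \<open>h * g l = l / 32\<close>, half of the total
    \<open>l / 16\<close> in the final contradiction.\<close>
  define h where "h = l / (32 * g l)"
  have h: "h > 0" using l gl by (simp add: h_def)
  define R where "R = (\<lambda>n. min (h * g (\<Delta> n)) (1 / 4 ^ n))"
  have R: "\<And>n. 0 < R n" "\<And>n. R n \<le> 1 / 4 ^ n" "\<And>n. R n \<le> h * g (\<Delta> n)"
    using h pos \<Delta>(1) by (auto simp: R_def)
  have "\<And>n. 4 ^ n * R n = min (h * (4 ^ n * g (\<Delta> n))) 1"
    by (simp add: R_def min_mult_distrib_left mult.left_commute)
  then have div: "\<not> summable (\<lambda>n. 4 ^ n * R n)"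
    using not_summable_min[OF \<Delta>(3) h] by simp
  \<comment> \<open>Since \<open>x\<close> is small compared with \<open>g x\<close>, from level
    \<open>k\<close> on the core radius \<open>\<Delta> n\<close> is at most half the separation
    radius \<open>R n\<close>.\<close>
  obtain d where d: "d > 0" "\<And>x. 0 < x \<Longrightarrow> x \<le> d \<Longrightarrow> x \<le> h / 2 * g x"
    using small_compared_to_gauge[of "h / 2"] h by auto
  obtain k where k: "1 / d < 4 ^ k" using real_arch_pow[of 4 "1 / d"] by auto
  have \<Delta>R: "2 * \<Delta> n \<le> R n" if "n \<ge> k" for n
  proof -
    have "\<Delta> n \<le> 1 / 4 ^ n" using \<Delta>(1,2)[of n] by linarith
    also have "\<dots> \<le> 1 / 4 ^ k" using that by (intro divide_left_mono power_increasing) auto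
    also have "\<dots> \<le> d" using k d(1) by (simp add: field_simps)
    finally show ?thesis using d(2)[of "\<Delta> n"] \<Delta>(1,2)[of n] by (simp add: R_def)
  qed
  obtain F :: "(real \<times> nat) set" where F: "finite F"
    and F1: "\<And>u. u \<in> F \<Longrightarrow> N + k \<le> snd u \<and> a + R (snd u) \<le> fst u \<and> fst u + R (snd u) \<le> b \<and>
       (\<exists>(q::nat) (p::int). 2 ^ snd u \<le> q \<and> q < 2 * 2 ^ snd u \<and> fst u = (of_int p + \<theta>) / real q)"
    and F2: "\<And>u v. u \<in> F \<Longrightarrow> v \<in> F \<Longrightarrow> u \<noteq> v \<Longrightarrow> R (snd u) + R (snd v) \<le> \<bar>fst u - fst v\<bar>"
    and F3: "l / 16 \<le> (\<Sum>u\<in>F. R (snd u))"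
    using separated_family[of a b R "N + k" \<theta>, OF ab R(1,2) div] unfolding l_def by metis
  define D where "D = (\<lambda>u :: real \<times> nat. \<Delta> (snd u))"
  define w where "w = (\<lambda>u :: real \<times> nat. R (snd u))"
  have Dw: "2 * D u \<le> w u" "0 < D u" if "u \<in> F" for u
    using \<Delta>R[of "snd u"] F1[OF that] \<Delta>(1) by (auto simp: D_def w_def)
  have core: "a \<le> fst u - D u" "fst u + D u \<le> b" if "u \<in> F" for u
    using F1[OF that] Dw[OF that] by (auto simp: w_def)
  define hit where "hit = (\<lambda>i u. i \<in> S \<and> c i - r i \<le> fst u + D u \<and> fst u - D u \<le> c i + r i)"
  define hit0 where "hit0 = (\<lambda>i. i \<in> S \<and> c i - r i \<le> b \<and> a \<le> c i + r i)"
  have hit_hit0: "hit0 i" if "hit i u" "u \<in> F" for i u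
    using that core[of u] by (auto simp: hit_def hit0_def)
  define \<tau> where "\<tau> = 1 / (224 * C)"
  have \<tau>: "\<tau> > 0" "\<tau> \<le> 1" using C by (auto simp: \<tau>_def)
  have cost': "(\<Sum>i. if hit0 i then ennreal (g (r i)) else 0) < ennreal (\<tau> * g l)"
    using cost by (simp add: hit_cost_def hit0_def \<tau>_def l_def)
  \<comment> \<open>A longer interval would by itself cost at least \<open>g l\<close>, more than
    the whole budget.\<close>
  have rl: "r i < l" if "hit0 i" for i
  proof -
    have "ennreal (g (r i)) \<le> (\<Sum>i. if hit0 i then ennreal (g (r i)) else 0)"
      using that sum_le_suminf[of "\<lambda>i. if hit0 i then ennreal (g (r i)) else 0" "{i}"] by simp
    also note cost'
    finally have "g (r i) < \<tau> * g l" using pos[OF r, of i] by (simp add: ennreal_less_iff)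
    also have "\<dots> \<le> g l" using \<tau> gl by simp
    finally show ?thesis using mono[OF l, of "r i"] by linarith
  qed
  define H where "H = (\<lambda>i. {u\<in>F. hit i u})"
  have finH: "finite (H i)" for i using F by (simp add: H_def)
  \<comment> \<open>The charge of interval \<open>i\<close> at the selected point \<open>u\<close>:
    the full weight of \<open>u\<close> if \<open>i\<close> meets at least two cores, otherwise a
    multiple of the gauge of \<open>i\<close>.\<close>
  define \<beta> where "\<beta> = (\<lambda>i u. if hit i u then (if card (H i) \<ge> 2 then w u else h / \<tau> * g (r i)) else 0)"
  have \<beta>0: "\<beta> i u \<ge> 0" for i u
    using R(1)[of "snd u"] h \<tau> pos[OF r, of i] by (auto simp: \<beta>_def w_def)
  define K where "K = 7 * C * l / g l + h / \<tau>"
  have K: "K > 0" using C l gl h \<tau> by (auto simp: K_def intro!: add_pos_pos)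
  have \<beta>_sum: "(\<Sum>u\<in>F. \<beta> i u) \<le> (if hit0 i then K * g (r i) else 0)" for i
  proof (cases "hit0 i")
    case False
    then have "(\<Sum>u\<in>F. \<beta> i u) = 0" using hit_hit0 by (intro sum.neutral) (auto simp: \<beta>_def)
    then show ?thesis using False by simp
  next
    case True
    have gr: "g (r i) > 0" using pos r by simp
    have eq: "(\<Sum>u\<in>F. \<beta> i u) = (\<Sum>u\<in>H i. if card (H i) \<ge> 2 then w u else h / \<tau> * g (r i))"
      unfolding \<beta>_def H_def using F by (simp add: sum.inter_filter)
    show ?thesis
    proof (cases "card (H i) \<ge> 2")
      case two: True
      have big: "w u \<le> 4 * r i" if "u \<in> H i" for u
      proof -
        have "\<exists>v. v \<in> H i \<and> v \<noteq> u"
        proof (rule ccontr)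
          assume "\<nexists>v. v \<in> H i \<and> v \<noteq> u"
          then have "H i \<subseteq> {u}" by auto
          then show False using two card_mono[of "{u}" "H i"] by simp
        qed
        then obtain v where v: "v \<in> H i" "v \<noteq> u" by blast
        have uv: "u \<in> F" "v \<in> F" "hit i u" "hit i v" using v that by (auto simp: H_def)
        have "w u + w v \<le> \<bar>fst u - fst v\<bar>" using F2[of u v] uv v by (simp add: w_def)
        also have "\<dots> \<le> 2 * r i + D u + D v" using uv(3,4) by (auto simp: hit_def)
        also have "\<dots> \<le> 2 * r i + w u / 2 + w v / 2" using Dw[OF uv(1)] Dw[OF uv(2)] by simp
        finally show ?thesis using Dw[OF uv(2)] by simp
      qed
      \<comment> \<open>The centres lie within \<open>r i + D u \<le> 3 * r i\<close> of
        \<open>c i\<close> and the radii are at most \<open>4 * r i\<close>, so these disjoint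
        intervals fit into radius \<open>7 * r i\<close>.\<close>
      have "(\<Sum>u\<in>H i. w u) \<le> 7 * r i"
      proof (rule disjoint_intervals_length_le[where c = fst and y = "c i"])
        fix u assume u: "u \<in> H i"
        then have "u \<in> F" "hit i u" by (auto simp: H_def)
        then show "\<bar>fst u - c i\<bar> + w u \<le> 7 * r i"
          using big[OF u] Dw[of u] by (auto simp: hit_def abs_le_iff)
        show "0 \<le> w u" using R(1) by (simp add: w_def less_imp_le)
      qed (use finH r F2 in \<open>auto simp: H_def w_def less_imp_le\<close>)
      also have "7 * r i \<le> 7 * C * l / g l * g (r i)"
        using linear_growth[OF r, of i l] rl[OF True] gl by (simp add: field_simps)
      also have "\<dots> \<le> K * g (r i)" using gr h \<tau> by (intro mult_right_mono) (auto simp: K_def)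
      finally show ?thesis using eq two True by simp
    next
      case False
      then have "card (H i) \<le> 1" by simp
      then have "(\<Sum>u\<in>F. \<beta> i u) \<le> 1 * (h / \<tau> * g (r i))"
        unfolding eq using False gr h \<tau> by (simp only: if_False sum_constant) (intro mult_right_mono, auto)
      also have "\<dots> \<le> K * g (r i)"
        using gr C l gl by (simp only: mult_1) (intro mult_right_mono, auto simp: K_def)
      finally show ?thesis using True by simp
    qed
  qed
  have "\<exists>u\<in>F. hit_cost c r S (fst u - D u) (fst u + D u) < ennreal (\<tau> * g (2 * D u))"
  proof (rule ccontr)
    assume "\<not> ?thesis"
    then have bad: "ennreal (\<tau> * g (2 * D u)) \<le> (\<Sum>i. if hit i u then ennreal (g (r i)) else 0)" if "u \<in> F" for u
      using that by (auto simp: hit_cost_def hit_def not_less)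
    \<comment> \<open>Either an interval meeting several cores pays the weight of \<open>u\<close>
      outright, or the single hits pay it because the core of \<open>u\<close> is assumed
      expensive.\<close>
    have w_le: "ennreal (w u) \<le> (\<Sum>i. ennreal (\<beta> i u))" if u: "u \<in> F" for u
    proof (cases "\<exists>i. hit i u \<and> card (H i) \<ge> 2")
      case True
      then obtain i where i: "hit i u" "card (H i) \<ge> 2" by blast
      then have "ennreal (w u) = ennreal (\<beta> i u)" by (simp add: \<beta>_def)
      also have "\<dots> \<le> (\<Sum>i. ennreal (\<beta> i u))"
        using sum_le_suminf[of "\<lambda>i. ennreal (\<beta> i u)" "{i}"] by simp
      finally show ?thesis .
    next
      case False
      then have \<beta>_eq: "\<beta> i u = (if hit i u then h / \<tau> * g (r i) else 0)" for i by (auto simp: \<beta>_def)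
      have "w u \<le> h * g (D u)" using R(3) by (simp add: w_def D_def)
      also have "\<dots> \<le> h * g (2 * D u)" using h mono[of "D u" "2 * D u"] Dw[OF u] by simp
      also have "\<dots> = h / \<tau> * (\<tau> * g (2 * D u))" using \<tau> by simp
      finally have "ennreal (w u) \<le> ennreal (h / \<tau> * (\<tau> * g (2 * D u)))" by (rule ennreal_leI)
      also have "\<dots> = ennreal (h / \<tau>) * ennreal (\<tau> * g (2 * D u))"
        using h \<tau> by (intro ennreal_mult') auto
      also have "\<dots> \<le> ennreal (h / \<tau>) * (\<Sum>i. if hit i u then ennreal (g (r i)) else 0)"
        using bad[OF u] by (intro mult_left_mono) auto
      also have "\<dots> = (\<Sum>i. ennreal (h / \<tau>) * (if hit i u then ennreal (g (r i)) else 0))"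
        by simp
      also have "\<dots> = (\<Sum>i. ennreal (\<beta> i u))"
        using h \<tau> by (intro suminf_cong) (auto simp: \<beta>_eq ennreal_mult'[symmetric])
      finally show ?thesis .
    qed
    have "ennreal (l / 16) \<le> ennreal (\<Sum>u\<in>F. w u)" using F3 by (intro ennreal_leI) (simp add: w_def)
    also have "\<dots> = (\<Sum>u\<in>F. ennreal (w u))" using R(1) by (intro sum_ennreal[symmetric]) (simp add: w_def less_imp_le)
    also have "\<dots> \<le> (\<Sum>u\<in>F. \<Sum>i. ennreal (\<beta> i u))" by (intro sum_mono w_le)
    also have "\<dots> = (\<Sum>i. \<Sum>u\<in>F. ennreal (\<beta> i u))" by (intro suminf_sum[symmetric] summableI)
    also have "\<dots> \<le> (\<Sum>i. ennreal K * (if hit0 i then ennreal (g (r i)) else 0))"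
    proof (intro suminf_le summableI)
      fix i
      have "(\<Sum>u\<in>F. ennreal (\<beta> i u)) = ennreal (\<Sum>u\<in>F. \<beta> i u)" using \<beta>0 by (intro sum_ennreal)
      also have "\<dots> \<le> ennreal (if hit0 i then K * g (r i) else 0)" by (intro ennreal_leI \<beta>_sum)
      also have "\<dots> = ennreal K * (if hit0 i then ennreal (g (r i)) else 0)"
        using K by (auto simp: ennreal_mult')
      finally show "(\<Sum>u\<in>F. ennreal (\<beta> i u)) \<le> \<dots>" .
    qed
    also have "\<dots> = ennreal K * (\<Sum>i. if hit0 i then ennreal (g (r i)) else 0)" by simp
    also have "\<dots> < ennreal K * ennreal (\<tau> * g l)"
      using K cost' by (intro ennreal_mult_strict_left_mono) auto
    also have "\<dots> = ennreal (K * (\<tau> * g l))" using K by (simp add: ennreal_mult')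
    \<comment> \<open>Multiple and single hits contribute \<open>l / 32\<close> each; this fixes
      \<open>224 = 7 * 32\<close>.\<close>
    also have "K * (\<tau> * g l) = l / 16"
    proof -
      have "K * (\<tau> * g l) = 7 * C * l * \<tau> + h * g l" using gl \<tau> by (simp add: K_def field_simps)
      also have "\<dots> = l / 16" using gl C by (simp add: h_def \<tau>_def)
      finally show ?thesis .
    qed
    finally show False by simp
  qed
  then obtain u where u: "u \<in> F" "hit_cost c r S (fst u - D u) (fst u + D u) < ennreal (\<tau> * g (2 * D u))"
    by blast
  show ?thesis
  proof (rule exI[of _ "snd u"], rule exI[of _ "fst u"], intro conjI)
    show "hit_cost c r S (fst u - \<Delta> (snd u)) (fst u + \<Delta> (snd u)) < ennreal (g (2 * \<Delta> (snd u)) / (224 * C))"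
      using u(2) by (simp add: D_def \<tau>_def)
    show "\<exists>(q::nat) (p::int). 2 ^ snd u \<le> q \<and> q < 2 * 2 ^ snd u \<and> fst u = (of_int p + \<theta>) / real q"
      using F1[OF u(1)] by blast
  qed (use F1[OF u(1)] core[OF u(1)] in \<open>auto simp: D_def\<close>)
qed

text \<open>Pigeonhole: an interval of radius at most \<open>1 / N\<close> meets at most four grid
  intervals. If all of these were expensive, \<open>N * g (1 / N)\<close> would be less than
  \<open>896 * M * C\<close>, where \<open>896 = 4 * 224\<close>.\<close>

lemma cheap_grid_interval:
  fixes c r :: "nat \<Rightarrow> real" and M :: real and N :: nat
  assumes N: "N \<ge> 1" and r: "\<And>i. 0 < r i" "\<And>i. r i \<le> 1 / real N"
    and cost: "(\<Sum>i. if i \<in> S then ennreal (g (r i)) else 0) < ennreal M"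
    and M: "1 / real N \<le> 1 / (896 * M * C) * g (1 / real N)" "M > 0"
  shows "\<exists>j<N. hit_cost c r S (real j / N) (real (Suc j) / N) < ennreal (g (1 / N) / (224 * C))"
proof (rule ccontr)
  assume "\<not> ?thesis"
  then have ge: "ennreal (g (1 / N) / (224 * C)) \<le> hit_cost c r S (real j / N) (real (Suc j) / N)" if "j < N" for j
    using that by (meson not_less)
  define P where "P = (\<lambda>i j. i \<in> S \<and> c i - r i \<le> real (Suc j) / N \<and> real j / N \<le> c i + r i)"
  have card: "card {j\<in>{..<N}. P i j} \<le> 4" for i
  proof -
    define m where "m = \<lceil>real N * (c i - r i) - 1\<rceil>"
    have "int ` {j\<in>{..<N}. P i j} \<subseteq> {m..m + 3}"
    proof (clarify)
      fix j assume "P i j"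
      then have "real N * (c i - r i) - 1 \<le> real j" "real j \<le> real N * (c i + r i)"
        using N by (auto simp: P_def field_simps)
      moreover have "real N * r i \<le> 1" using r(2)[of i] N by (simp add: field_simps)
      ultimately have "real N * (c i - r i) - 1 \<le> of_int (int j)" "real j \<le> real N * (c i - r i) - 1 + 3"
        by (auto simp: algebra_simps)
      then show "int j \<in> {m..m + 3}" unfolding m_def by (auto simp: ceiling_le_iff) linarith+
    qed
    then have "card (int ` {j\<in>{..<N}. P i j}) \<le> card {m..m + 3}" by (intro card_mono) auto
    then show ?thesis by (simp add: card_image)
  qed
  have "ennreal (real N * (g (1 / N) / (224 * C))) = (\<Sum>j<N. ennreal (g (1 / N) / (224 * C)))"
    by (subst ennreal_mult') (simp_all add: ennreal_of_nat_eq_real_of_nat)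
  also have "\<dots> \<le> (\<Sum>j<N. hit_cost c r S (real j / N) (real (Suc j) / N))"
    by (intro sum_mono ge) auto
  also have "\<dots> = (\<Sum>i. \<Sum>j<N. if P i j then ennreal (g (r i)) else 0)"
    unfolding hit_cost_def P_def by (intro suminf_sum[symmetric] summableI)
  also have "\<dots> \<le> (\<Sum>i. ennreal 4 * (if i \<in> S then ennreal (g (r i)) else 0))"
  proof (intro suminf_le summableI)
    fix i
    have "(\<Sum>j<N. if P i j then ennreal (g (r i)) else 0) = of_nat (card {j\<in>{..<N}. P i j}) * ennreal (g (r i))"
      by (simp add: sum.inter_filter[symmetric])
    also have "\<dots> \<le> of_nat 4 * ennreal (g (r i))"
      using card[of i] by (intro mult_right_mono of_nat_mono) auto
    finally show "(\<Sum>j<N. if P i j then ennreal (g (r i)) else 0)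
      \<le> ennreal 4 * (if i \<in> S then ennreal (g (r i)) else 0)"
      by (cases "i \<in> S") (auto simp: P_def)
  qed
  also have "\<dots> = ennreal 4 * (\<Sum>i. if i \<in> S then ennreal (g (r i)) else 0)" by simp
  also have "\<dots> < ennreal 4 * ennreal M" using cost by (intro ennreal_mult_strict_left_mono) auto
  also have "\<dots> = ennreal (4 * M)" using M(2) by (simp add: ennreal_mult)
  finally have "real N * (g (1 / N) / (224 * C)) < 4 * M"
    using M(2) by (subst (asm) ennreal_less_iff) (use C N pos[of "1 / real N"] in auto)
  then have "real N * g (1 / N) < 896 * M * C" using C by (simp add: field_simps)
  moreover have "896 * M * C \<le> real N * g (1 / N)"
    using M N C by (simp add: field_simps)
  ultimately show False by simp
qed

text \<open>Iterating \<open>descent\<close> from a cheap grid interval gives nested intervals whose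
  lengths tend to \<open>0\<close>, and their common point is the desired one. The scale
  \<open>\<rho>\<close> depends on \<open>M\<close> but not on the cover, as slicing
  requires.\<close>

lemma exists_avoiding_point:
  fixes \<Delta> :: "nat \<Rightarrow> real" and \<theta> M :: real
  assumes \<Delta>: "\<And>n. 0 < \<Delta> n" "\<And>n. 2 * \<Delta> n \<le> 1 / 4 ^ n" "\<not> summable (\<lambda>n. 4 ^ n * g (\<Delta> n))"
    and M: "M > 0"
  shows "\<exists>\<rho>>0. \<forall>c r S. (\<forall>i. 0 < r i \<and> r i \<le> \<rho>) \<longrightarrow>
     (\<Sum>i. if i \<in> S then ennreal (g (r i)) else 0) < ennreal M \<longrightarrow>
     (\<exists>x\<in>{0..1}. (\<forall>i\<in>S. r i < \<bar>x - c i\<bar>) \<and>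
        (\<forall>k. \<exists>n\<ge>k. \<exists>(q::nat) (p::int). 2 ^ n \<le> q \<and> q < 2 * 2 ^ n \<and> \<bar>x - (of_int p + \<theta>) / real q\<bar> \<le> \<Delta> n))"
proof -
  have "1 / (896 * M * C) > 0" using M C by simp
  then obtain d where d: "d > 0" "\<And>x. 0 < x \<Longrightarrow> x \<le> d \<Longrightarrow> x \<le> 1 / (896 * M * C) * g x"
    using small_compared_to_gauge by blast
  obtain N :: nat where N: "real N > 1 / d" using reals_Archimedean2 by blast
  then have N1: "N \<ge> 1" using d(1) by (cases N) auto
  have Nd: "1 / real N \<le> d" using N N1 d(1) by (simp add: field_simps)
  have "\<exists>x\<in>{0..1}. (\<forall>i\<in>S. r i < \<bar>x - c i\<bar>) \<and>
        (\<forall>k. \<exists>n\<ge>k. \<exists>(q::nat) (p::int). 2 ^ n \<le> q \<and> q < 2 * 2 ^ n \<and> \<bar>x - (of_int p + \<theta>) / real q\<bar> \<le> \<Delta> n)"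
    if r: "\<forall>i. 0 < r i \<and> r i \<le> 1 / real N"
      and cost: "(\<Sum>i. if i \<in> S then ennreal (g (r i)) else 0) < ennreal M" for c r and S :: "nat set"
  proof -
    \<comment> \<open>The invariant is cheapness relative to the gauge of the length;
      \<open>step k\<close> demands a level at least \<open>k\<close>, so that arbitrarily high
      levels occur.\<close>
    define good where "good = (\<lambda>I. fst I < snd I \<and> hit_cost c r S (fst I) (snd I) < ennreal (g (snd I - fst I) / (224 * C)))"
    define step where "step = (\<lambda>k I J. fst I \<le> fst J \<and> snd J \<le> snd I \<and>
      (\<exists>n\<ge>k. \<exists>(q::nat) (p::int). 2 ^ n \<le> q \<and> q < 2 * 2 ^ n \<and>
         fst J = (of_int p + \<theta>) / real q - \<Delta> n \<and> snd J = (of_int p + \<theta>) / real q + \<Delta> n))"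
    obtain j where j: "j < N" "hit_cost c r S (real j / N) (real (Suc j) / N) < ennreal (g (1 / N) / (224 * C))"
      using cheap_grid_interval[OF N1, of r S M c] r cost d(2)[of "1 / real N"] Nd N1 M by auto
    have base: "good (real j / N, real (Suc j) / N)"
      using j N1 by (simp add: good_def divide_strict_right_mono flip: diff_divide_distrib)
    have next_ex: "\<exists>J. good J \<and> step k I J" if "good I" for k I
    proof -
      from that have "fst I < snd I" "hit_cost c r S (fst I) (snd I) < ennreal (g (snd I - fst I) / (224 * C))"
        by (auto simp: good_def)
      from descent[OF this(1) _ \<Delta> this(2), of k \<theta>] r obtain n x and q :: nat and p :: int where
        n: "k \<le> n" "2 ^ n \<le> q" "q < 2 * 2 ^ n" "x = (of_int p + \<theta>) / real q"
        "fst I \<le> x - \<Delta> n" "x + \<Delta> n \<le> snd I"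
        "hit_cost c r S (x - \<Delta> n) (x + \<Delta> n) < ennreal (g (2 * \<Delta> n) / (224 * C))" by blast
      have "good (x - \<Delta> n, x + \<Delta> n)" using n(7) \<Delta>(1)[of n] by (simp add: good_def)
      moreover have "step k I (x - \<Delta> n, x + \<Delta> n)" using n by (auto simp: step_def)
      ultimately show ?thesis by blast
    qed
    have "\<exists>I. \<forall>k. (good (I k) \<and> (k = 0 \<longrightarrow> I k = (real j / N, real (Suc j) / N))) \<and> step k (I k) (I (Suc k))"
      by (rule dependent_nat_choice) (use base next_ex in auto)
    then obtain I where I: "\<And>k. good (I k)" "I 0 = (real j / N, real (Suc j) / N)" "\<And>k. step k (I k) (I (Suc k))"
      by blast
    define A where "A = (\<lambda>k. fst (I k))"
    define B where "B = (\<lambda>k. snd (I k))"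
    have AB: "A k < B k" for k using I(1)[of k] by (simp add: good_def A_def B_def)
    have "incseq A" using I(3) by (intro incseq_SucI) (simp add: step_def A_def)
    have "decseq B" using I(3) by (intro decseq_SucI) (simp add: step_def B_def)
    have AB': "A i \<le> B k" for i k
    proof -
      have "A i \<le> A (max i k)" using \<open>incseq A\<close> by (simp add: incseq_def)
      also have "\<dots> \<le> B (max i k)" using AB less_imp_le by blast
      also have "\<dots> \<le> B k" using \<open>decseq B\<close> by (simp add: decseq_def)
      finally show ?thesis .
    qed
    define x where "x = (SUP k. A k)"
    have xA: "A k \<le> x" for k
      unfolding x_def by (intro cSUP_upper bdd_aboveI2[where M = "B 0"] AB') auto
    have xB: "x \<le> B k" for k
      unfolding x_def by (intro cSUP_least AB') auto
    have "x \<in> {0..1}"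
    proof -
      have "0 \<le> A 0" "B 0 \<le> 1" using I(2) j N1 by (auto simp: A_def B_def)
      then show ?thesis using xA[of 0] xB[of 0] by simp
    qed
    moreover have "\<forall>i\<in>S. r i < \<bar>x - c i\<bar>"
    proof (rule ccontr)
      assume "\<not> ?thesis"
      then obtain i where i: "i \<in> S" "\<bar>x - c i\<bar> \<le> r i" by auto
      \<comment> \<open>Interval \<open>i\<close> contains \<open>x\<close>, so it is charged to
        every nested interval; cheapness and monotonicity of \<open>g\<close> then bound its radius
        by their lengths.\<close>
      have len: "r i < B k - A k" for k
      proof -
        have "c i - r i \<le> B k" "A k \<le> c i + r i" using i(2) xA[of k] xB[of k] by (auto simp: abs_le_iff)
        then have "ennreal (g (r i)) \<le> hit_cost c r S (A k) (B k)"
          unfolding hit_cost_def using i(1)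
            sum_le_suminf[of "\<lambda>i. if i \<in> S \<and> c i - r i \<le> B k \<and> A k \<le> c i + r i then ennreal (g (r i)) else 0" "{i}"]
          by simp
        also have "\<dots> < ennreal (g (B k - A k) / (224 * C))"
          using I(1)[of k] by (simp add: good_def A_def B_def)
        also have "\<dots> \<le> ennreal (g (B k - A k))"
          using C pos[of "B k - A k"] AB[of k] by (intro ennreal_leI) (simp add: divide_le_eq)
        finally have "g (r i) < g (B k - A k)"
          using pos[of "r i"] r by (subst (asm) ennreal_less_iff) (auto simp: less_imp_le)
        then show ?thesis using mono[of "B k - A k" "r i"] AB[of k] by force
      qed
      have "r i \<le> (1 / 4) ^ k" for k
      proof -
        obtain n where n: "n \<ge> k" "B (Suc k) - A (Suc k) = 2 * \<Delta> n"
          using I(3)[of k] by (auto simp: step_def A_def B_def)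
        have "r i \<le> 1 / 4 ^ n" using len[of "Suc k"] n(2) \<Delta>(2)[of n] by simp
        also have "\<dots> \<le> 1 / 4 ^ k" using n(1) by (intro divide_left_mono power_increasing) auto
        finally show ?thesis by (simp add: power_one_over)
      qed
      moreover obtain k where "(1 / 4 :: real) ^ k < r i" using r real_arch_pow_inv[of "r i" "1/4"] by auto
      ultimately show False by (meson not_le)
    qed
    moreover have "\<exists>n\<ge>k. \<exists>(q::nat) (p::int). 2 ^ n \<le> q \<and> q < 2 * 2 ^ n \<and> \<bar>x - (of_int p + \<theta>) / real q\<bar> \<le> \<Delta> n" for k
    proof -
      obtain n and q :: nat and p :: int where n: "n \<ge> k" "2 ^ n \<le> q" "q < 2 * 2 ^ n"
        "A (Suc k) = (of_int p + \<theta>) / real q - \<Delta> n" "B (Suc k) = (of_int p + \<theta>) / real q + \<Delta> n"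
        using I(3)[of k] unfolding step_def A_def B_def by blast
      then have "\<bar>x - (of_int p + \<theta>) / real q\<bar> \<le> \<Delta> n" using xA[of "Suc k"] xB[of "Suc k"] by (auto simp: abs_le_iff)
      with n show ?thesis by blast
    qed
    ultimately show ?thesis by blast
  qed
  moreover have "1 / real N > 0" using N1 by simp
  ultimately show ?thesis by blast
qed

end

section \<open>Slicing and the divergence case\<close>

lemma emeasure_lborel_cbox_cart:
  fixes l u :: "real ^ 'd"
  assumes "\<And>j. l $ j \<le> u $ j"
  shows "emeasure lborel (cbox l u) = ennreal (\<Prod>j\<in>UNIV. u $ j - l $ j)"
proof -
  have "cbox l u \<noteq> {}" using assms by (auto simp: interval_ne_empty_cart)
  then have "measure lborel (cbox l u) = (\<Prod>j\<in>UNIV. u $ j - l $ j)" by (rule content_cbox_cart)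
  then show ?thesis using emeasure_eq_measure2[OF fmeasurable_compact[OF compact_cbox[of l u]]] by simp
qed

lemma unit_cube_eq_cbox: "unit_cube = cbox (0 :: real ^ 'd) 1"
  by (auto simp: unit_cube_def mem_box_cart)

text \<open>Integrating over the cube the one-dimensional covering bound along each line in direction \<open>k\<close>
  turns the gauge \<open>g\<close> into \<open>r ^ (d - 1) * g r\<close>.\<close>

lemma hausdorff_premeasure_slicing:
  fixes f g :: "real \<Rightarrow> real" and W :: "(real ^ 'd) set" and k :: 'd and \<rho> M A :: real
  assumes f0: "(f \<longlongrightarrow> 0) (at_right 0)"
    and fg: "\<And>r. r > 0 \<Longrightarrow> f r = r ^ (CARD('d) - 1) * g r"
    and \<rho>: "\<rho> > 0"
    and line: "\<And>c r S. (\<forall>i. 0 < r i \<and> r i \<le> \<rho>) \<Longrightarrow>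
      (\<Sum>i. if i \<in> S then ennreal (g (r i)) else 0) < ennreal M \<Longrightarrow>
      \<exists>x\<in>{0..1}. (\<forall>i\<in>S. r i < \<bar>x - c i\<bar>) \<and> x \<in> V"
    and W: "\<And>x y. y \<in> unit_cube \<Longrightarrow> x \<in> {0..1} \<Longrightarrow> x \<in> V \<Longrightarrow> (\<chi> j. if j = k then x else y $ j) \<in> W"
    and less: "hausdorff_premeasure f \<rho> (W \<inter> unit_cube) < ennreal A"
  shows "M \<le> 2 ^ (CARD('d) - 1) * (A + 2)"
proof -
  have A: "A > 0" using less by (metis ennreal_neg not_gr_zero not_le not_less_zero order_le_less)
  obtain B :: "nat \<Rightarrow> (real ^ 'd) set" where B: "W \<inter> unit_cube \<subseteq> (\<Union>i. B i)"
    "\<And>i. bounded (B i)" "\<And>i. diameter (B i) \<le> \<rho>" "(\<Sum>i. diam_weight f (B i)) < ennreal A"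
    using less unfolding hausdorff_premeasure_def by (auto simp: INF_less_iff)
  \<comment> \<open>Sets of diameter \<open>0\<close> weigh nothing, but the bound on lines needs
    positive radii. The substitutes \<open>e i\<close> cost at most \<open>2\<close> altogether,
    whence \<open>A + 2\<close>.\<close>
  have "\<exists>e. 0 < e \<and> e \<le> \<rho> \<and> f e \<le> (1 / 2) ^ i" for i :: nat
  proof -
    have "\<forall>\<^sub>F e in at_right 0. f e < (1 / 2) ^ i" using f0 by (rule order_tendstoD) simp
    moreover have "\<forall>\<^sub>F e in at_right 0. e \<in> {0<..<\<rho>}" using \<rho> by (rule eventually_at_right_real)
    ultimately have "\<forall>\<^sub>F e in at_right (0::real). 0 < e \<and> e \<le> \<rho> \<and> f e \<le> (1 / 2) ^ i"
      by eventually_elim auto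
    then show ?thesis by (rule eventually_happens'[OF trivial_limit_at_right_real])
  qed
  then obtain e where e: "\<And>i. 0 < e i" "\<And>i. e i \<le> \<rho>" "\<And>i. f (e i) \<le> (1 / 2) ^ i" by metis
  define c where "c = (\<lambda>i. SOME x. x \<in> B i)"
  define r where "r = (\<lambda>i. if diameter (B i) = 0 then e i else diameter (B i))"
  have r: "0 < r i" "r i \<le> \<rho>" "diameter (B i) \<le> r i" for i
    using e[of i] B(3)[of i] diameter_ge_0[OF B(2)[of i]] by (auto simp: r_def less_le)
  have near: "\<bar>x $ j - c i $ j\<bar> \<le> r i" if "x \<in> B i" for x i j
  proof -
    have "c i \<in> B i" unfolding c_def using that by (rule someI)
    then have "dist x (c i) \<le> diameter (B i)" using B(2) that by (intro diameter_bounded_bound)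
    moreover have "\<bar>x $ j - c i $ j\<bar> \<le> dist x (c i)"
      using component_le_norm_cart[of "x - c i" j] by (simp add: dist_norm)
    ultimately show ?thesis using r(3)[of i] by linarith
  qed
  \<comment> \<open>The box from \<open>l i\<close> to \<open>u i\<close> describes the lines in
    direction \<open>k\<close> that may meet \<open>B i\<close>: it has side \<open>1\<close> in
    coordinate \<open>k\<close> and half-side \<open>r i\<close> in the others.\<close>
  define l where "l = (\<lambda>i. (\<chi> j. if j = k then 0 else c i $ j - r i) :: real ^ 'd)"
  define u where "u = (\<lambda>i. (\<chi> j. if j = k then 1 else c i $ j + r i) :: real ^ 'd)"
  have lu: "l i $ j \<le> u i $ j" for i j using r(1)[of i] by (simp add: l_def u_def)
  \<comment> \<open>If the intervals on the line through \<open>y\<close> cost less than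
    \<open>M\<close>, the line would contain a point of \<open>W\<close> in the cube missed by every
    \<open>B i\<close>.\<close>
  have slice: "ennreal M * indicator (cbox 0 1) y \<le> (\<Sum>i. ennreal (g (r i)) * indicator (cbox (l i) (u i)) y)" for y
  proof (cases "y \<in> unit_cube")
    case False
    then show ?thesis by (simp add: unit_cube_eq_cbox)
  next
    case True
    define S where "S = {i. \<forall>j. j \<noteq> k \<longrightarrow> \<bar>y $ j - c i $ j\<bar> \<le> r i}"
    have "ennreal M \<le> (\<Sum>i. if i \<in> S then ennreal (g (r i)) else 0)"
    proof (rule ccontr)
      assume "\<not> ?thesis"
      then have "(\<Sum>i. if i \<in> S then ennreal (g (r i)) else 0) < ennreal M" by simp
      from line[OF _ this, of "\<lambda>i. c i $ k"] r obtain x where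
        x: "x \<in> {0..1}" "x \<in> V" "\<And>i. i \<in> S \<Longrightarrow> r i < \<bar>x - c i $ k\<bar>" by blast
      define z where "z = (\<chi> j. if j = k then x else y $ j)"
      have "z \<in> W" unfolding z_def using True x by (intro W)
      moreover have "z \<in> unit_cube" using True x(1) by (auto simp: z_def unit_cube_def)
      ultimately obtain i where i: "z \<in> B i" using B(1) by blast
      have "i \<in> S" unfolding S_def
      proof (intro CollectI allI impI)
        fix j assume "j \<noteq> k"
        then show "\<bar>y $ j - c i $ j\<bar> \<le> r i" using near[OF i, of j] by (simp add: z_def)
      qed
      then show False using x(3) near[OF i, of k] by (force simp: z_def)
    qed
    also have "\<dots> = (\<Sum>i. ennreal (g (r i)) * indicator (cbox (l i) (u i)) y)"
    proof (intro suminf_cong)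
      fix i
      have "y \<in> cbox (l i) (u i) \<longleftrightarrow> i \<in> S"
        using True by (auto simp: mem_box_cart l_def u_def S_def unit_cube_def abs_le_iff) (force+)?
      then show "(if i \<in> S then ennreal (g (r i)) else 0) = ennreal (g (r i)) * indicator (cbox (l i) (u i)) y"
        by simp
    qed
    finally show ?thesis using True by (simp add: unit_cube_eq_cbox)
  qed
  have "ennreal M = (\<integral>\<^sup>+ y. ennreal M * indicator (cbox 0 (1 :: real ^ 'd)) y \<partial>lborel)"
    by (simp add: nn_integral_cmult_indicator emeasure_lborel_cbox_cart)
  also have "\<dots> \<le> (\<integral>\<^sup>+ y. (\<Sum>i. ennreal (g (r i)) * indicator (cbox (l i) (u i)) y) \<partial>lborel)"
    by (intro nn_integral_mono slice)
  also have "\<dots> = (\<Sum>i. ennreal (g (r i)) * emeasure lborel (cbox (l i) (u i)))"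
    by (subst nn_integral_suminf) (auto simp: nn_integral_cmult_indicator)
  also have "\<dots> = (\<Sum>i. ennreal (2 ^ (CARD('d) - 1)) * ennreal (f (r i)))"
  proof (intro suminf_cong)
    fix i
    have "(\<Prod>j\<in>UNIV. u i $ j - l i $ j) = (u i $ k - l i $ k) * (\<Prod>j\<in>UNIV - {k}. u i $ j - l i $ j)"
      by (rule prod.remove) auto
    also have "\<dots> = (\<Prod>j\<in>UNIV - {k}. 2 * r i)"
      by (auto simp: u_def l_def intro!: prod.cong)
    also have "\<dots> = (2 * r i) ^ (CARD('d) - 1)" by (simp add: card_Diff_singleton)
    finally have em: "emeasure lborel (cbox (l i) (u i)) = ennreal ((2 * r i) ^ (CARD('d) - 1))"
      using lu by (simp add: emeasure_lborel_cbox_cart)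
    have "ennreal (g (r i)) * ennreal ((2 * r i) ^ (CARD('d) - 1)) = ennreal (g (r i) * (2 * r i) ^ (CARD('d) - 1))"
      using r(1)[of i] by (intro ennreal_mult''[symmetric]) simp
    also have "g (r i) * (2 * r i) ^ (CARD('d) - 1) = 2 ^ (CARD('d) - 1) * f (r i)"
      unfolding fg[OF r(1)] by (simp add: power_mult_distrib)
    also have "ennreal \<dots> = ennreal (2 ^ (CARD('d) - 1)) * ennreal (f (r i))"
      by (intro ennreal_mult') simp
    finally show "ennreal (g (r i)) * emeasure lborel (cbox (l i) (u i)) = ennreal (2 ^ (CARD('d) - 1)) * ennreal (f (r i))"
      unfolding em .
  qed
  also have "\<dots> \<le> (\<Sum>i. ennreal (2 ^ (CARD('d) - 1)) * (diam_weight f (B i) + ennreal ((1 / 2) ^ i)))"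
  proof (intro suminf_le summableI mult_left_mono)
    fix i
    show "ennreal (f (r i)) \<le> diam_weight f (B i) + ennreal ((1 / 2) ^ i)"
      using e(3)[of i] by (auto simp: r_def diam_weight_def intro: ennreal_leI)
  qed auto
  also have "\<dots> = ennreal (2 ^ (CARD('d) - 1)) * ((\<Sum>i. diam_weight f (B i)) + (\<Sum>i. ennreal ((1 / 2) ^ i)))"
    by (simp add: suminf_add[symmetric])
  also have "(\<Sum>i. ennreal ((1 / 2) ^ i)) = ennreal 2"
    by (subst suminf_ennreal2) (auto simp: suminf_geometric intro: summable_geometric)
  also have "ennreal (2 ^ (CARD('d) - 1)) * ((\<Sum>i. diam_weight f (B i)) + ennreal 2)
     \<le> ennreal (2 ^ (CARD('d) - 1)) * (ennreal A + ennreal 2)"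
    using B(4) by (intro mult_left_mono add_mono) auto
  also have "\<dots> = ennreal (2 ^ (CARD('d) - 1) * (A + 2))"
    using A by (subst ennreal_mult') (simp_all add: ennreal_plus)
  finally show ?thesis using A by (subst (asm) ennreal_le_iff) auto
qed

section \<open>Approximation in a single coordinate\<close>

lemma dist_nearest_int_le: "dist_nearest_int z \<le> \<bar>z - of_int m\<bar>"
  unfolding dist_nearest_int_def by (rule round_diff_minimal)

lemma dist_nearest_int_bounds: "0 \<le> dist_nearest_int z" "dist_nearest_int z \<le> 1 / 2"
  unfolding dist_nearest_int_def using of_int_round_abs_le[of z] by (auto simp: abs_minus_commute)

lemma mult_approx_set_if_coordinate_approx:
  fixes \<theta> :: "real ^ 'd" and k :: 'd
  assumes appr: "\<And>m. \<exists>q>m. \<exists>p::int. \<bar>z $ k - (of_int p + \<theta> $ k) / real q\<bar> < \<psi> q / real q"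
  shows "z \<in> mult_approx_set \<psi> \<theta>"
  unfolding mult_approx_set_def infinite_nat_iff_unbounded
proof (intro CollectI allI)
  fix m
  obtain q and p :: int where q: "q > m" "\<bar>z $ k - (of_int p + \<theta> $ k) / real q\<bar> < \<psi> q / real q"
    using appr by blast
  have q0: "real q > 0" using q(1) by simp
  have "\<bar>real q * z $ k - \<theta> $ k - of_int p\<bar> = real q * \<bar>z $ k - (of_int p + \<theta> $ k) / real q\<bar>"
  proof -
    have "real q * z $ k - \<theta> $ k - of_int p = real q * (z $ k - (of_int p + \<theta> $ k) / real q)"
      using q0 by (simp add: field_simps)
    then show ?thesis using q0 by (simp add: abs_mult)
  qed
  also have "\<dots> < \<psi> q" using q(2) q0 by (simp add: field_simps)
  finally have lt: "dist_nearest_int (real q * z $ k - \<theta> $ k) < \<psi> q"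
    using dist_nearest_int_le[of "real q * z $ k - \<theta> $ k" p] by linarith
  have "(\<Prod>i\<in>UNIV. dist_nearest_int (real q * z $ i - \<theta> $ i))
      = dist_nearest_int (real q * z $ k - \<theta> $ k) * (\<Prod>i\<in>UNIV - {k}. dist_nearest_int (real q * z $ i - \<theta> $ i))"
    by (rule prod.remove) auto
  also have "\<dots> \<le> dist_nearest_int (real q * z $ k - \<theta> $ k) * 1"
    using dist_nearest_int_bounds
    by (intro mult_left_mono prod_le_1) (auto intro: order_trans[OF dist_nearest_int_bounds(2)])
  finally show "\<exists>n>m. n \<in> {q. 1 \<le> q \<and> (\<Prod>i\<in>UNIV. dist_nearest_int (real q * z $ i - \<theta> $ i)) < \<psi> q}"
    using lt q(1) by (intro exI[of _ q]) auto
qed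

section \<open>Infinite measure from divergence over dyadic levels\<close>

context gauge
begin

text \<open>Linear growth keeps every capped term above the positive constant \<open>c\<close>.
  Convergence of the truncated series would thus make the cap inactive eventually.\<close>

lemma not_summable_truncation:
  fixes \<delta> :: "nat \<Rightarrow> real"
  assumes \<delta>: "\<And>n. 0 < \<delta> n" and div: "\<not> summable (\<lambda>n. 4 ^ n * g (\<delta> n))"
  shows "\<not> summable (\<lambda>n. 4 ^ n * g (min (\<delta> n) (1 / (2 * 4 ^ n))))"
proof
  assume S: "summable (\<lambda>n. 4 ^ n * g (min (\<delta> n) (1 / (2 * 4 ^ n))))"
  define c where "c = g 1 / (2 * C)"
  have c: "c > 0" using pos[of 1] C by (simp add: c_def)
  have lower: "c \<le> 4 ^ n * g (1 / (2 * 4 ^ n))" for n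
  proof -
    have "1 / (2 * 4 ^ n) * g 1 \<le> C * 1 * g (1 / (2 * 4 ^ n))"
      by (rule linear_growth) (auto simp: divide_le_eq intro: order_trans[of 1 "4 ^ n"])
    then show ?thesis using C by (simp add: c_def field_simps)
  qed
  have "(\<lambda>n. 4 ^ n * g (min (\<delta> n) (1 / (2 * 4 ^ n)))) \<longlonglongrightarrow> 0" using S by (rule summable_LIMSEQ_zero)
  then have "\<forall>\<^sub>F n in sequentially. 4 ^ n * g (min (\<delta> n) (1 / (2 * 4 ^ n))) < c"
    using c by (rule order_tendstoD)
  then have "\<forall>\<^sub>F n in sequentially. 4 ^ n * g (min (\<delta> n) (1 / (2 * 4 ^ n))) = 4 ^ n * g (\<delta> n)"
  proof eventually_elim
    case (elim n)
    with lower[of n] have "min (\<delta> n) (1 / (2 * 4 ^ n)) \<noteq> 1 / (2 * 4 ^ n)" by auto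
    then show ?case by (auto simp: min_def split: if_splits)
  qed
  with S have "summable (\<lambda>n. 4 ^ n * g (\<delta> n))" by (subst (asm) summable_cong) auto
  then show False using div by simp
qed

text \<open>One radius \<open>\<delta> n\<close> works for all denominators of a dyadic block. For
  each \<open>A\<close>, the avoiding point and slicing exclude covers of cost below
  \<open>A\<close> at some scale.\<close>

lemma hausdorff_measure_mult_approx_set_infinite:
  fixes \<theta> :: "real ^ 'd" and \<psi> \<delta> :: "nat \<Rightarrow> real" and f :: "real \<Rightarrow> real"
  assumes f0: "(f \<longlongrightarrow> 0) (at_right 0)"
    and fg: "\<And>r. r > 0 \<Longrightarrow> f r = r ^ (CARD('d) - 1) * g r"
    and \<delta>: "\<And>n. 0 < \<delta> n" "\<And>n q. 2 ^ n \<le> q \<Longrightarrow> q < 2 * 2 ^ n \<Longrightarrow> \<delta> n < \<psi> q / real q"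
    and div: "\<not> summable (\<lambda>n. 4 ^ n * g (\<delta> n))"
  shows "hausdorff_measure f (mult_approx_set \<psi> \<theta> \<inter> unit_cube) = \<infinity>"
proof -
  \<comment> \<open>Any coordinate will do; \<open>undefined\<close> merely names one.\<close>
  define k :: 'd where "k = undefined"
  define \<Delta> where "\<Delta> = (\<lambda>n. min (\<delta> n) (1 / (2 * 4 ^ n)))"
  have \<Delta>: "0 < \<Delta> n" "2 * \<Delta> n \<le> 1 / 4 ^ n" "\<Delta> n \<le> \<delta> n" for n
  proof -
    have "\<Delta> n \<le> 1 / (2 * 4 ^ n)" by (simp add: \<Delta>_def)
    then show "2 * \<Delta> n \<le> 1 / 4 ^ n" by (simp add: field_simps)
  qed (use \<delta>(1)[of n] in \<open>auto simp: \<Delta>_def\<close>)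
  have div': "\<not> summable (\<lambda>n. 4 ^ n * g (\<Delta> n))"
    unfolding \<Delta>_def by (rule not_summable_truncation[OF \<delta>(1) div])
  define V where "V = {x. \<forall>m. \<exists>n\<ge>m. \<exists>(q::nat) (p::int). 2 ^ n \<le> q \<and> q < 2 * 2 ^ n \<and>
    \<bar>x - (of_int p + \<theta> $ k) / real q\<bar> \<le> \<Delta> n}"
  have W: "(\<chi> j. if j = k then x else y $ j) \<in> mult_approx_set \<psi> \<theta>" if x: "x \<in> V" for x and y :: "real ^ 'd"
  proof (rule mult_approx_set_if_coordinate_approx[where k = k])
    fix m
    obtain n and q :: nat and p :: int where n: "m \<le> n" "2 ^ n \<le> q" "q < 2 * 2 ^ n"
      "\<bar>x - (of_int p + \<theta> $ k) / real q\<bar> \<le> \<Delta> n"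
      using x unfolding V_def by blast
    have "m < q" using n(1,2) less_exp[of n] by linarith
    moreover have "\<bar>x - (of_int p + \<theta> $ k) / real q\<bar> < \<psi> q / real q"
      using n(4) \<Delta>(3)[of n] \<delta>(2)[OF n(2,3)] by linarith
    ultimately show "\<exists>q>m. \<exists>p::int. \<bar>(\<chi> j. if j = k then x else y $ j) $ k - (of_int p + \<theta> $ k) / real q\<bar> < \<psi> q / real q"
      by auto
  qed
  have "ennreal A \<le> hausdorff_measure f (mult_approx_set \<psi> \<theta> \<inter> unit_cube)" if A: "A > 0" for A
  proof -
    \<comment> \<open>Just above \<open>2 ^ (CARD('d) - 1) * (A + 2)\<close>, the most that slicing
      permits for a cover of cost below \<open>A\<close>.\<close>
    define M where "M = 2 ^ (CARD('d) - 1) * (A + 3)"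
    have "M > 0" using A by (simp add: M_def)
    from exists_avoiding_point[OF \<Delta>(1,2) div' this, of "\<theta> $ k"] obtain \<rho> where \<rho>: "\<rho> > 0"
      and line: "\<forall>c r S. (\<forall>i. 0 < r i \<and> r i \<le> \<rho>) \<longrightarrow>
        (\<Sum>i. if i \<in> S then ennreal (g (r i)) else 0) < ennreal M \<longrightarrow>
        (\<exists>x\<in>{0..1}. (\<forall>i\<in>S. r i < \<bar>x - c i\<bar>) \<and> x \<in> V)"
      by (elim exE conjE) (rule that, assumption, simp only: V_def mem_Collect_eq)
    have "ennreal A \<le> hausdorff_premeasure f \<rho> (mult_approx_set \<psi> \<theta> \<inter> unit_cube)"
    proof (rule ccontr)
      assume "\<not> ?thesis"
      then have "hausdorff_premeasure f \<rho> (mult_approx_set \<psi> \<theta> \<inter> unit_cube) < ennreal A" by simp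
      then have "M \<le> 2 ^ (CARD('d) - 1) * (A + 2)"
        by (intro hausdorff_premeasure_slicing[OF f0 fg \<rho>, where W = "mult_approx_set \<psi> \<theta>" and k = k and V = V])
          (use line W in blast)+
      then show False by (simp add: M_def)
    qed
    also have "\<dots> \<le> hausdorff_measure f (mult_approx_set \<psi> \<theta> \<inter> unit_cube)"
      unfolding hausdorff_measure_eq_SUP using \<rho> by (intro SUP_upper) auto
    finally show ?thesis .
  qed
  then have "of_nat n \<le> hausdorff_measure f (mult_approx_set \<psi> \<theta> \<inter> unit_cube)" for n
    by (cases "n = 0") (auto simp: ennreal_of_nat_eq_real_of_nat)
  then show ?thesis using ennreal_SUP_of_nat_eq_top by (metis SUP_least infinity_ennreal_def top_unique)
qed

text \<open>Cauchy condensation: the block of \<open>q\<close> from \<open>2 * 2 ^ n\<close> to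
  below \<open>4 * 2 ^ n\<close> has \<open>2 * 2 ^ n\<close> terms, each at most
  \<open>4 * 2 ^ n * g (\<delta> n)\<close>, and so adds at most
  \<open>8 * 4 ^ n * g (\<delta> n)\<close>.\<close>

lemma dyadic_not_summable:
  fixes \<psi> :: "nat \<Rightarrow> real"
  assumes \<psi>: "\<And>q. q \<ge> 1 \<Longrightarrow> \<psi> q > 0" "antimono_on {1..} \<psi>"
    and div: "\<not> summable (\<lambda>m. real (Suc m) * g (\<psi> (Suc m) / real (Suc m)))"
  shows "\<not> summable (\<lambda>n. 4 ^ n * g (\<psi> (2 * 2 ^ n) / (2 * 2 ^ n)))"
proof
  define \<delta> where "\<delta> = (\<lambda>n::nat. \<psi> (2 * 2 ^ n) / (2 * 2 ^ n))"
  have \<delta>pos: "\<delta> n > 0" for n using \<psi>(1)[of "2 * 2 ^ n"] by (simp add: \<delta>_def)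
  assume "summable (\<lambda>n. 4 ^ n * g (\<psi> (2 * 2 ^ n) / (2 * 2 ^ n)))"
  then have S: "summable (\<lambda>n. 8 * (4 ^ n * g (\<delta> n)))" by (intro summable_mult) (simp add: \<delta>_def)
  define a where "a = (\<lambda>q. real q * g (\<psi> q / real q))"
  have a0: "a q \<ge> 0" if "q \<ge> 1" for q
    using that pos[of "\<psi> q / real q"] \<psi>(1)[of q] by (auto simp: a_def less_imp_le)
  have a_le: "a q \<le> 4 * 2 ^ n * g (\<delta> n)" if q: "2 * 2 ^ n \<le> q" "q < 4 * 2 ^ n" for q n
  proof -
    have q1: "q \<ge> 1" using q(1) by (metis One_nat_def Suc_leI le_trans mult_pos_pos pos2 zero_less_power)
    have "real (2 * 2 ^ n) \<le> real q" using q(1) by (simp only: of_nat_le_iff)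
    then have rq: "2 * 2 ^ n \<le> real q" by simp
    have "\<psi> q \<le> \<psi> (2 * 2 ^ n)" using \<psi>(2) q(1) q1 by (auto simp: monotone_on_def)
    then have "\<psi> q / real q \<le> \<delta> n"
      unfolding \<delta>_def using rq \<psi>(1)[OF q1] by (intro frac_le) auto
    then have "g (\<psi> q / real q) \<le> g (\<delta> n)" using \<psi>(1)[OF q1] q1 by (intro mono) auto
    moreover have "real q \<le> real (4 * 2 ^ n)" using q(2) by (simp only: of_nat_le_iff)
    ultimately show ?thesis unfolding a_def using pos[of "\<psi> q / real q"] \<psi>(1)[OF q1] q1
      by (intro mult_mono) auto
  qed
  have block: "(\<Sum>q=2..<2 * 2 ^ N. a q) \<le> (\<Sum>n<N. 8 * (4 ^ n * g (\<delta> n)))" for N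
  proof (induction N)
    case (Suc N)
    have "(\<Sum>q=2..<2 * 2 ^ Suc N. a q) = (\<Sum>q=2..<2 * 2 ^ N. a q) + (\<Sum>q=2 * 2 ^ N..<4 * 2 ^ N. a q)"
      by (subst sum.atLeastLessThan_concat) auto
    also have "(\<Sum>q=2 * 2 ^ N..<4 * 2 ^ N. a q) \<le> (\<Sum>q=2 * 2 ^ N..<(4 * 2 ^ N::nat). 4 * 2 ^ N * g (\<delta> N))"
      by (intro sum_mono a_le) auto
    also have "\<dots> = 8 * (4 ^ N * g (\<delta> N))"
    proof -
      have "(2::real) ^ N * 2 ^ N = 4 ^ N" by (simp flip: power_mult_distrib)
      then show ?thesis by simp
    qed
    finally show ?case using Suc.IH by simp
  qed simp
  \<comment> \<open>The blocks start at \<open>q = 2\<close>; a shift restores the term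
    \<open>q = 1\<close> afterwards.\<close>
  have "summable (\<lambda>m. a (m + 2))"
  proof (rule summableI_nonneg_bounded)
    fix M
    have "(\<Sum>m<M. a (m + 2)) = (\<Sum>q=2..<M + 2. a q)"
      by (rule sum.reindex_bij_witness[of _ "\<lambda>q. q - 2" "\<lambda>m. m + 2"]) auto
    also have "\<dots> \<le> (\<Sum>q=2..<2 * 2 ^ M. a q)"
    proof (rule sum_mono2)
      have "M + 1 \<le> 2 ^ M" using less_exp[of M] by linarith
      then show "{2..<M + 2} \<subseteq> {2..<2 * 2 ^ M}" by auto
    qed (auto intro: a0)
    also have "\<dots> \<le> (\<Sum>n<M. 8 * (4 ^ n * g (\<delta> n)))" by (rule block)
    also have "\<dots> \<le> (\<Sum>n. 8 * (4 ^ n * g (\<delta> n)))"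
      using S pos \<delta>pos by (intro sum_le_suminf) (auto simp: less_imp_le)
    finally show "(\<Sum>m<M. a (m + 2)) \<le> (\<Sum>n. 8 * (4 ^ n * g (\<delta> n)))" .
  qed (auto intro: a0)
  then have "summable (\<lambda>m. a (Suc m))"
    using summable_iff_shift[of "\<lambda>m. a (Suc m)" 1] by simp
  then show False using div by (simp add: a_def)
qed

text \<open>Serves increasing \<open>\<psi>\<close>, which is bounded below by
  \<open>\<psi> 1\<close>. Linear growth keeps the terms above
  \<open>g \<kappa> / (2 * C)\<close>.\<close>

lemma constant_not_summable:
  assumes "\<kappa> > 0"
  shows "\<not> summable (\<lambda>n. 4 ^ n * g (\<kappa> / (2 * 2 ^ n)))"
proof
  assume "summable (\<lambda>n. 4 ^ n * g (\<kappa> / (2 * 2 ^ n)))"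
  then have "(\<lambda>n. 4 ^ n * g (\<kappa> / (2 * 2 ^ n))) \<longlonglongrightarrow> 0" by (rule summable_LIMSEQ_zero)
  moreover have "g \<kappa> / (2 * C) > 0" using pos[OF assms] C by simp
  ultimately have "\<forall>\<^sub>F n in sequentially. 4 ^ n * g (\<kappa> / (2 * 2 ^ n)) < g \<kappa> / (2 * C)"
    by (rule order_tendstoD)
  then obtain n where n: "4 ^ n * g (\<kappa> / (2 * 2 ^ n)) < g \<kappa> / (2 * C)"
    by (auto simp: eventually_sequentially)
  define x where "x = \<kappa> / (2 * 2 ^ n)"
  have one: "(1::real) \<le> 2 * 2 ^ n" using one_le_power[of "2::real" n] by linarith
  have x: "x > 0" "x \<le> \<kappa>" "\<kappa> = 2 * 2 ^ n * x" using assms one by (auto simp: x_def field_simps)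
  have gx: "g x > 0" using pos x by simp
  have "x * g \<kappa> \<le> C * \<kappa> * g x" using x by (intro linear_growth)
  then have "g \<kappa> \<le> 2 * C * 2 ^ n * g x" using x(1) by (simp add: x(3) field_simps)
  also have "\<dots> \<le> 2 * C * 4 ^ n * g x" using C gx by (intro mult_right_mono mult_left_mono power_mono) auto
  finally show False using n C by (simp add: x_def field_simps)
qed

end

section \<open>Covers by cells and the convergence case\<close>

lemma hausdorff_premeasure_finite_cover:
  assumes "finite Z" "S \<subseteq> (\<Union>z\<in>Z. B z)" "\<And>z. z \<in> Z \<Longrightarrow> bounded (B z) \<and> diameter (B z) \<le> \<rho>" "\<rho> \<ge> 0"
  shows "hausdorff_premeasure f \<rho> S \<le> (\<Sum>z\<in>Z. diam_weight f (B z))"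
proof -
  obtain e where e: "bij_betw e {..<card Z} Z" using \<open>finite Z\<close> bij_betw_from_nat_into_finite by blast
  \<comment> \<open>The empty sets used as padding have diameter and weight \<open>0\<close>, and
    \<open>\<rho> \<ge> 0\<close> admits them.\<close>
  define B' where "B' = (\<lambda>i. if i < card Z then B (e i) else {})"
  have "hausdorff_premeasure f \<rho> S \<le> (\<Sum>i. diam_weight f (B' i))"
    unfolding hausdorff_premeasure_def
  proof (intro INF_lower CollectI conjI allI)
    show "S \<subseteq> (\<Union>i. B' i)"
    proof
      fix x assume "x \<in> S"
      then obtain z where z: "z \<in> Z" "x \<in> B z" using assms(2) by blast
      then obtain i where "i < card Z" "z = e i" using e by (auto simp: bij_betw_def)
      then show "x \<in> (\<Union>i. B' i)" using z by (auto simp: B'_def)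
    qed
    fix i
    have "i < card Z \<Longrightarrow> e i \<in> Z" using e by (auto simp: bij_betw_def)
    then show "bounded (B' i)" "diameter (B' i) \<le> \<rho>" using assms(3,4) by (auto simp: B'_def)
  qed
  also have "\<dots> = (\<Sum>i<card Z. diam_weight f (B' i))"
    by (intro suminf_finite) (auto simp: B'_def diam_weight_def)
  also have "\<dots> = (\<Sum>i<card Z. diam_weight f (B (e i)))" by (simp add: B'_def)
  also have "\<dots> = (\<Sum>z\<in>Z. diam_weight f (B z))" by (rule sum.reindex_bij_betw[OF e])
  finally show ?thesis .
qed

lemma hausdorff_premeasure_countable_subadditive:
  fixes A :: "nat \<Rightarrow> 'a::metric_space set"
  assumes "S \<subseteq> (\<Union>n. A n)"
  shows "hausdorff_premeasure f \<rho> S \<le> (\<Sum>n. hausdorff_premeasure f \<rho> (A n))"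
proof (rule ennreal_le_epsilon)
  fix e :: real
  assume fin: "(\<Sum>n. hausdorff_premeasure f \<rho> (A n)) < top" and e: "0 < e"
  have "\<exists>B :: nat \<Rightarrow> 'a set. (A n \<subseteq> (\<Union>i. B i) \<and> (\<forall>i. bounded (B i) \<and> diameter (B i) \<le> \<rho>)) \<and>
      (\<Sum>i. diam_weight f (B i)) < hausdorff_premeasure f \<rho> (A n) + ennreal (e / 2 * (1 / 2) ^ n)" for n
  proof -
    have "hausdorff_premeasure f \<rho> (A n) \<le> (\<Sum>n. hausdorff_premeasure f \<rho> (A n))"
      using sum_le_suminf[of "\<lambda>n. hausdorff_premeasure f \<rho> (A n)" "{n}"] by simp
    with fin have "hausdorff_premeasure f \<rho> (A n) < top" by simp
    \<comment> \<open>Strictness rests on finiteness, since adding to \<open>top\<close> changes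
      nothing.\<close>
    then have "hausdorff_premeasure f \<rho> (A n) < hausdorff_premeasure f \<rho> (A n) + ennreal (e / 2 * (1 / 2) ^ n)"
      using e ennreal_add_left_cancel_less[of "hausdorff_premeasure f \<rho> (A n)" 0] by simp
    then show ?thesis
      by (subst (asm) (1) hausdorff_premeasure_def) (auto simp: INF_less_iff)
  qed
  then obtain B :: "nat \<Rightarrow> nat \<Rightarrow> 'a set" where B: "\<And>n. A n \<subseteq> (\<Union>i. B n i)"
    "\<And>n i. bounded (B n i) \<and> diameter (B n i) \<le> \<rho>"
    "\<And>n. (\<Sum>i. diam_weight f (B n i)) < hausdorff_premeasure f \<rho> (A n) + ennreal (e / 2 * (1 / 2) ^ n)"
    by metis
  define B' where "B' = (\<lambda>i. case_prod B (prod_decode i))"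
  have "hausdorff_premeasure f \<rho> S \<le> (\<Sum>i. diam_weight f (B' i))"
    unfolding hausdorff_premeasure_def
  proof (intro INF_lower CollectI conjI allI)
    show "S \<subseteq> (\<Union>i. B' i)"
    proof
      fix x assume "x \<in> S"
      then obtain n i where "x \<in> B n i" using assms B(1) by blast
      then have "x \<in> B' (prod_encode (n, i))" by (simp add: B'_def)
      then show "x \<in> (\<Union>i. B' i)" by blast
    qed
  qed (use B(2) in \<open>auto simp: B'_def split: prod.split\<close>)
  also have "\<dots> = (\<Sum>n. \<Sum>i. diam_weight f (B n i))"
    using suminf_ennreal_2dimen[of "\<lambda>n. \<Sum>i. diam_weight f (B n i)" "\<lambda>(n, i). diam_weight f (B n i)"]
    by (simp add: B'_def case_prod_beta)
  also have "\<dots> \<le> (\<Sum>n. hausdorff_premeasure f \<rho> (A n) + ennreal (e / 2 * (1 / 2) ^ n))"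
    using B(3) by (intro suminf_le summableI) (auto simp: less_imp_le)
  also have "\<dots> = (\<Sum>n. hausdorff_premeasure f \<rho> (A n)) + (\<Sum>n. ennreal (e / 2 * (1 / 2) ^ n))"
    by (intro suminf_add[symmetric] summableI)
  also have "(\<Sum>n. ennreal (e / 2 * (1 / 2) ^ n)) = ennreal e"
  proof (subst suminf_ennreal2)
    show "summable (\<lambda>n. e / 2 * (1 / 2) ^ n)" by (intro summable_mult summable_geometric) simp
    have "(\<Sum>n. e / 2 * (1 / 2) ^ n) = e / 2 * (\<Sum>n. (1 / 2) ^ n)"
      by (intro suminf_mult summable_geometric) simp
    then show "ennreal (\<Sum>n. e / 2 * (1 / 2) ^ n) = ennreal e" by (simp add: suminf_geometric)
  qed (use e in auto)
  finally show "hausdorff_premeasure f \<rho> S \<le> (\<Sum>n. hausdorff_premeasure f \<rho> (A n)) + ennreal e" .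
qed

text \<open>Here \<open>v i = (p, s, m)\<close> records the integer \<open>p\<close> nearest to \<open>q x\<^sub>i - \<theta>\<^sub>i\<close>, the side \<open>s\<close> on which
  it is missed, and the distance to it, rounded up to \<open>m\<close> steps of length \<open>\<delta>\<close>. In the index
  sets below, \<open>k\<close> is the coordinate with the smallest distance, which is less than \<open>2 \<delta>\<close>.\<close>

definition approx_cell :: "nat \<Rightarrow> real ^ 'd \<Rightarrow> real \<Rightarrow> ('d \<Rightarrow> int \<times> bool \<times> nat) \<Rightarrow> (real ^ 'd) set" where
  "approx_cell q \<theta> \<delta> v = {x. \<forall>i. case v i of (p, s, m) \<Rightarrow>
     (if s then 1 else - 1) * (real q * x $ i - \<theta> $ i - of_int p) \<in> {(real m - 1) * \<delta>..real m * \<delta>}}"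

definition cell_range :: "nat \<Rightarrow> real ^ 'd \<Rightarrow> real \<Rightarrow> 'd \<Rightarrow> 'd \<Rightarrow> (int \<times> bool \<times> nat) set" where
  "cell_range q \<theta> \<delta> k i = {\<lceil>- \<theta> $ i - 1 / 2\<rceil>..\<lfloor>real q - \<theta> $ i + 1 / 2\<rfloor>} \<times> UNIV \<times>
     (if i = k then {1, 2} else {1..nat \<lfloor>1 / \<delta>\<rfloor>})"

definition cell_indices :: "nat \<Rightarrow> real ^ 'd \<Rightarrow> real \<Rightarrow> real \<Rightarrow> 'd \<Rightarrow> ('d \<Rightarrow> int \<times> bool \<times> nat) set" where
  "cell_indices q \<theta> \<delta> X k = {v \<in> PiE UNIV (cell_range q \<theta> \<delta> k). (\<Prod>i\<in>UNIV. real (snd (snd (v i)))) \<le> X}"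

text \<open>Every coordinate varies by at most \<open>\<delta> / q\<close>, and the Euclidean norm
  is at most the sum of the coordinate sizes.\<close>

lemma approx_cell_small:
  fixes \<theta> :: "real ^ 'd"
  assumes "q \<ge> 1" "\<delta> > 0"
  shows "bounded (approx_cell q \<theta> \<delta> v)" "diameter (approx_cell q \<theta> \<delta> v) \<le> real CARD('d) * \<delta> / real q"
proof -
  have close: "norm (x - y) \<le> real CARD('d) * \<delta> / real q"
    if xy: "x \<in> approx_cell q \<theta> \<delta> v" "y \<in> approx_cell q \<theta> \<delta> v" for x y
  proof -
    have "\<bar>(x - y) $ i\<bar> \<le> \<delta> / real q" for i
    proof -
      obtain p s m where v: "v i = (p, s, m)" by (cases "v i")
      have "(if s then 1 else - 1) * (real q * x $ i - \<theta> $ i - of_int p) \<in> {(real m - 1) * \<delta>..real m * \<delta>}"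
        "(if s then 1 else - 1) * (real q * y $ i - \<theta> $ i - of_int p) \<in> {(real m - 1) * \<delta>..real m * \<delta>}"
        using xy v unfolding approx_cell_def by (auto dest!: spec[of _ i] split: if_splits)
      then have "\<bar>real q * x $ i - real q * y $ i\<bar> \<le> \<delta>"
        by (cases s) (auto simp: abs_le_iff algebra_simps)
      moreover have "\<bar>real q * x $ i - real q * y $ i\<bar> = real q * \<bar>(x - y) $ i\<bar>"
        by (simp add: abs_mult flip: right_diff_distrib)
      ultimately show ?thesis using assms by (simp add: field_simps)
    qed
    then have "(\<Sum>i\<in>UNIV. \<bar>(x - y) $ i\<bar>) \<le> (\<Sum>i\<in>(UNIV::'d set). \<delta> / real q)" by (intro sum_mono)
    then show ?thesis using norm_le_l1_cart[of "x - y"] by simp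
  qed
  then show "diameter (approx_cell q \<theta> \<delta> v) \<le> real CARD('d) * \<delta> / real q"
    using assms by (intro diameter_le) auto
  show "bounded (approx_cell q \<theta> \<delta> v)"
  proof (cases "approx_cell q \<theta> \<delta> v = {}")
    case False
    then obtain x where x: "x \<in> approx_cell q \<theta> \<delta> v" by blast
    show ?thesis
      unfolding bounded_def using close[OF x] by (intro exI[of _ x]) (auto simp: dist_norm)
  qed auto
qed

section \<open>Number of cells at one dyadic level\<close>

lemma finite_cell_range: "finite (cell_range q \<theta> \<delta> k i)"
  by (auto simp: cell_range_def)

lemma finite_cell_indices: "finite (cell_indices q (\<theta> :: real ^ 'd) \<delta> X k)"
  unfolding cell_indices_def by (intro finite_Collect_conjI disjI1) (simp add: finite_PiE finite_cell_range)

text \<open>Markov's inequality for the weight \<open>\<Prod> m\<^sub>i powr - \<eta>\<close>; summing over all coordinates at once with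
  \<open>\<eta> < 1\<close> avoids the logarithms of a direct count.\<close>

lemma card_cell_indices_le:
  fixes \<theta> :: "real ^ 'd" and \<eta> :: real
  assumes q: "q \<ge> 1" and \<delta>: "\<delta> > 0" and X: "X > 0" and \<eta>: "0 \<le> \<eta>" "\<eta> < 1"
  shows "real (card (cell_indices q \<theta> \<delta> X k)) \<le>
    X powr \<eta> * ((6 * real q) ^ CARD('d) * (2 * ((1 / \<delta>) powr (1 - \<eta>) / (1 - \<eta>)) ^ (CARD('d) - 1)))"
proof -
  define w where "w = (\<lambda>z :: int \<times> bool \<times> nat. real (snd (snd z)) powr - \<eta>)"
  have m1: "snd (snd (v i)) \<ge> 1" if "v \<in> cell_indices q \<theta> \<delta> X k" for v i
  proof -
    have "v i \<in> cell_range q \<theta> \<delta> k i" using that by (auto simp: cell_indices_def PiE_iff)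
    then show ?thesis by (auto simp: cell_range_def split: if_splits)
  qed
  have "real (card (cell_indices q \<theta> \<delta> X k)) = (\<Sum>v\<in>cell_indices q \<theta> \<delta> X k. 1)" by simp
  also have "\<dots> \<le> (\<Sum>v\<in>cell_indices q \<theta> \<delta> X k. X powr \<eta> * (\<Prod>i\<in>UNIV. w (v i)))"
  proof (rule sum_mono)
    fix v assume v: "v \<in> cell_indices q \<theta> \<delta> X k"
    define P where "P = (\<Prod>i\<in>(UNIV::'d set). real (snd (snd (v i))))"
    have "P > 0" unfolding P_def using m1[OF v] by (intro prod_pos) (auto simp: Suc_le_eq)
    have "P \<le> X" using v by (simp add: cell_indices_def P_def)
    then have "P powr \<eta> \<le> X powr \<eta>" using \<open>P > 0\<close> \<eta> by (intro powr_mono2) auto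
    moreover have "(\<Prod>i\<in>UNIV. w (v i)) = P powr - \<eta>" by (simp add: P_def w_def prod_powr_distrib)
    ultimately show "1 \<le> X powr \<eta> * (\<Prod>i\<in>UNIV. w (v i))"
      using \<open>P > 0\<close> by (simp add: powr_minus_divide)
  qed
  \<comment> \<open>Dropping the constraint on the product lets the weighted sum factor over the
    coordinates.\<close>
  also have "\<dots> \<le> (\<Sum>v\<in>PiE UNIV (cell_range q \<theta> \<delta> k). X powr \<eta> * (\<Prod>i\<in>UNIV. w (v i)))"
    by (intro sum_mono2 finite_PiE finite_cell_range mult_nonneg_nonneg prod_nonneg) (auto simp: cell_indices_def w_def)
  also have "\<dots> = X powr \<eta> * (\<Prod>i\<in>UNIV. \<Sum>z\<in>cell_range q \<theta> \<delta> k i. w z)"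
    by (subst prod_sum_PiE) (auto simp: finite_cell_range sum_distrib_left)
  also have "\<dots> \<le> X powr \<eta> * (\<Prod>i\<in>UNIV. 6 * real q * (if i = k then 2 else (1 / \<delta>) powr (1 - \<eta>) / (1 - \<eta>)))"
  proof (intro mult_left_mono prod_mono conjI)
    fix i
    define S where "S = (if i = k then {1, 2} else {1..nat \<lfloor>1 / \<delta>\<rfloor>})"
    define P where "P = {\<lceil>- \<theta> $ i - 1 / 2\<rceil>..\<lfloor>real q - \<theta> $ i + 1 / 2\<rfloor>}"
    show "0 \<le> (\<Sum>z\<in>cell_range q \<theta> \<delta> k i. w z)" by (intro sum_nonneg) (simp add: w_def)
    have "real (card P) \<le> (real q - \<theta> $ i + 1 / 2) - (- \<theta> $ i - 1 / 2) + 1"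
      unfolding P_def by (rule card_int_interval_le) simp
    then have cP: "real (card P) \<le> 3 * real q" using q by simp
    have S: "(\<Sum>m\<in>S. real m powr - \<eta>) \<le> (if i = k then 2 else (1 / \<delta>) powr (1 - \<eta>) / (1 - \<eta>))"
    proof (cases "i = k")
      case True
      have "(2::real) powr - \<eta> \<le> 2 powr 0" using \<eta> by (intro powr_mono) auto
      then show ?thesis using True by (simp add: S_def)
    next
      case False
      then have "(\<Sum>m\<in>S. real m powr - \<eta>) \<le> real (nat \<lfloor>1 / \<delta>\<rfloor>) powr (1 - \<eta>) / (1 - \<eta>)"
        using sum_powr_le[OF \<eta>] by (simp add: S_def)
      also have "\<dots> \<le> (1 / \<delta>) powr (1 - \<eta>) / (1 - \<eta>)"
        using \<eta> \<delta> by (intro divide_right_mono powr_mono2) auto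
      finally show ?thesis using False by simp
    qed
    \<comment> \<open>At most \<open>3 * q\<close> integers and two sides give the factor
      \<open>6 * q\<close>; only the step counts carry weight.\<close>
    have "(\<Sum>z\<in>cell_range q \<theta> \<delta> k i. w z) = real (card P) * (2 * (\<Sum>m\<in>S. real m powr - \<eta>))"
      unfolding cell_range_def P_def[symmetric] S_def[symmetric] w_def
      by (simp add: sum.cartesian_product' UNIV_bool)
    also have "\<dots> \<le> 3 * real q * (2 * (if i = k then 2 else (1 / \<delta>) powr (1 - \<eta>) / (1 - \<eta>)))"
      using cP S by (intro mult_mono mult_left_mono) (auto intro: sum_nonneg)
    finally show "(\<Sum>z\<in>cell_range q \<theta> \<delta> k i. w z)
        \<le> 6 * real q * (if i = k then 2 else (1 / \<delta>) powr (1 - \<eta>) / (1 - \<eta>))" by simp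
  qed auto
  also have "(\<Prod>i\<in>(UNIV::'d set). 6 * real q * (if i = k then 2 else (1 / \<delta>) powr (1 - \<eta>) / (1 - \<eta>)))
      = (6 * real q) ^ CARD('d) * (\<Prod>i\<in>(UNIV::'d set). if i = k then 2 else (1 / \<delta>) powr (1 - \<eta>) / (1 - \<eta>))"
    by (simp add: prod.distrib)
  also have "(\<Prod>i\<in>(UNIV::'d set). if i = k then 2 else (1 / \<delta>) powr (1 - \<eta>) / (1 - \<eta>))
      = 2 * ((1 / \<delta>) powr (1 - \<eta>) / (1 - \<eta>)) ^ (CARD('d) - 1)"
  proof -
    have "(\<Prod>i\<in>(UNIV::'d set). if i = k then 2 else (1 / \<delta>) powr (1 - \<eta>) / (1 - \<eta>))
      = 2 * (\<Prod>i\<in>UNIV - {k}. if i = k then 2 else (1 / \<delta>) powr (1 - \<eta>) / (1 - \<eta>))"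
      by (subst prod.remove[of _ k]) auto
    also have "(\<Prod>i\<in>UNIV - {k}. if i = k then 2 else (1 / \<delta>) powr (1 - \<eta>) / (1 - \<eta>))
      = (\<Prod>i\<in>UNIV - {k}. (1 / \<delta>) powr (1 - \<eta>) / (1 - \<eta>))" by (intro prod.cong) auto
    also have "\<dots> = ((1 / \<delta>) powr (1 - \<eta>) / (1 - \<eta>)) ^ (CARD('d) - 1)"
      by (simp add: card_Diff_singleton)
    finally show ?thesis .
  qed
  finally show ?thesis .
qed

text \<open>With \<open>\<delta>\<close> dyadically adapted to the smallest distance
  \<open>\<mu>\<close>, two cases bound the product of the step counts. If
  \<open>\<delta> \<le> \<mu>\<close>, each count is at most
  \<open>2 * \<bar>u i\<bar> / \<delta>\<close> and the product hypothesis applies. If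
  \<open>j = 0\<close>, then \<open>\<delta> = \<psi>\<close>, the count at \<open>k\<close> is at
  most \<open>2\<close> and the others are at most \<open>1 / \<delta>\<close>.\<close>

lemma exists_approx_cell:
  fixes \<theta> x :: "real ^ 'd" and \<psi> :: real
  assumes q: "q \<ge> 1" and \<psi>: "0 < \<psi>" "\<psi> \<le> 1 / 2" and x: "x \<in> unit_cube"
    and less: "(\<Prod>i\<in>UNIV. dist_nearest_int (real q * x $ i - \<theta> $ i)) < \<psi>"
  shows "\<exists>j k. 2 ^ j * \<psi> \<le> 1 / 2 \<and>
    (\<exists>v\<in>cell_indices q \<theta> (2 ^ j * \<psi>) (2 ^ CARD('d) * \<psi> / (2 ^ j * \<psi>) ^ CARD('d)) k. x \<in> approx_cell q \<theta> (2 ^ j * \<psi>) v)"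
proof -
  define p where "p = (\<lambda>i. round (real q * x $ i - \<theta> $ i))"
  define u where "u = (\<lambda>i. real q * x $ i - \<theta> $ i - of_int (p i))"
  have u_dist: "\<bar>u i\<bar> = dist_nearest_int (real q * x $ i - \<theta> $ i)" for i
    by (simp add: u_def p_def dist_nearest_int_def)
  have u_half: "\<bar>u i\<bar> \<le> 1 / 2" for i unfolding u_dist by (rule dist_nearest_int_bounds)
  define \<mu> where "\<mu> = Min (range (\<lambda>i. \<bar>u i\<bar>))"
  have "\<mu> \<in> range (\<lambda>i. \<bar>u i\<bar>)" unfolding \<mu>_def by (intro Min_in) auto
  then obtain k where k: "\<bar>u k\<bar> = \<mu>" by auto
  have \<mu>_le: "\<mu> \<le> \<bar>u i\<bar>" for i unfolding \<mu>_def by (intro Min_le) auto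
  obtain n where n: "\<mu> / (2 * \<psi>) < 2 ^ n" using real_arch_pow[of 2 "\<mu> / (2 * \<psi>)"] by auto
  \<comment> \<open>Minimality gives \<open>\<delta> \<le> \<mu>\<close> unless
    \<open>j = 0\<close>.\<close>
  define j where "j = (LEAST n. \<mu> < 2 * (2 ^ n * \<psi>))"
  define \<delta> where "\<delta> = 2 ^ j * \<psi>"
  have \<delta>0: "\<delta> > 0" using \<psi> by (simp add: \<delta>_def)
  have \<mu>\<delta>: "\<mu> < 2 * \<delta>" unfolding \<delta>_def j_def
  proof (rule LeastI[of "\<lambda>n. \<mu> < 2 * (2 ^ n * \<psi>)" n])
    show "\<mu> < 2 * (2 ^ n * \<psi>)" using n \<psi> by (simp add: field_simps)
  qed
  have j: "j = 0 \<or> \<delta> \<le> \<mu>"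
  proof (cases j)
    case (Suc i)
    then have "\<not> \<mu> < 2 * (2 ^ i * \<psi>)" using not_less_Least[of i "\<lambda>n. \<mu> < 2 * (2 ^ n * \<psi>)"] by (simp add: j_def)
    then show ?thesis by (simp add: \<delta>_def Suc)
  qed simp
  have \<delta>_half: "\<delta> \<le> 1 / 2" using j \<psi>(2) u_half[of k] k by (auto simp: \<delta>_def)
  \<comment> \<open>Floor plus one, so that the count is positive even when
    \<open>u i = 0\<close>.\<close>
  define m where "m = (\<lambda>i. nat \<lfloor>\<bar>u i\<bar> / \<delta>\<rfloor> + 1)"
  have m: "real (m i) - 1 \<le> \<bar>u i\<bar> / \<delta>" "\<bar>u i\<bar> / \<delta> \<le> real (m i)" "m i \<ge> 1" for i
    using \<delta>0 by (auto simp: m_def of_nat_nat) linarith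
  have mk: "m k \<in> {1, 2}"
  proof -
    have "\<mu> / \<delta> < 2" using \<mu>\<delta> \<delta>0 by (simp add: divide_less_eq)
    then have "m k < 3" using m(1)[of k] k by simp
    then show ?thesis using m(3)[of k] by auto
  qed
  have m_le: "real (m i) \<le> 1 / \<delta>" for i
  proof -
    have "\<bar>u i\<bar> / \<delta> \<le> (1 / 2) / \<delta>" using u_half \<delta>0 by (intro divide_right_mono) auto
    moreover have "(1 / 2) / \<delta> + 1 \<le> 1 / \<delta>" using \<delta>_half \<delta>0 by (simp add: field_simps)
    ultimately show ?thesis using m(1)[of i] by linarith
  qed
  define v where "v = (\<lambda>i. (p i, u i \<ge> 0, m i))"
  have "x \<in> approx_cell q \<theta> \<delta> v"
    unfolding approx_cell_def
  proof (intro CollectI allI)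
    fix i
    have "real q * x $ i - \<theta> $ i - of_int (p i) = u i" by (simp only: u_def)
    moreover have "(real (m i) - 1) * \<delta> \<le> \<bar>u i\<bar>" "\<bar>u i\<bar> \<le> real (m i) * \<delta>"
      using m[of i] \<delta>0 by (simp_all add: pos_le_divide_eq pos_divide_le_eq)
    ultimately show "case v i of (p, s, m) \<Rightarrow>
      (if s then 1 else - 1) * (real q * x $ i - \<theta> $ i - of_int p) \<in> {(real m - 1) * \<delta>..real m * \<delta>}"
      by (cases "0 \<le> u i") (simp_all add: v_def)
  qed
  moreover have "v \<in> PiE UNIV (cell_range q \<theta> \<delta> k)"
  proof (intro PiE_I)
    fix i :: 'd
    have "0 \<le> x $ i" "x $ i \<le> 1" using x by (auto simp: unit_cube_def)
    then have "0 \<le> real q * x $ i" "real q * x $ i \<le> real q" by (auto intro: mult_left_le)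
    then have "- \<theta> $ i - 1 / 2 \<le> of_int (p i)" "of_int (p i) \<le> real q - \<theta> $ i + 1 / 2"
      using u_half[of i] unfolding u_def by linarith+
    then have "p i \<in> {\<lceil>- \<theta> $ i - 1 / 2\<rceil>..\<lfloor>real q - \<theta> $ i + 1 / 2\<rfloor>}"
      by (simp only: atLeastAtMost_iff ceiling_le_iff le_floor_iff)
    moreover have "m i \<in> {1..nat \<lfloor>1 / \<delta>\<rfloor>}"
      using m(3)[of i] m_le[of i] by (auto simp: le_nat_floor)
    ultimately show "v i \<in> cell_range q \<theta> \<delta> k i"
      using mk unfolding v_def cell_range_def by auto
  qed simp
  moreover have "(\<Prod>i\<in>UNIV. real (m i)) \<le> 2 ^ CARD('d) * \<psi> / \<delta> ^ CARD('d)"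
    using j
  proof
    assume "\<delta> \<le> \<mu>"
    have "(\<Prod>i\<in>UNIV. real (m i)) \<le> (\<Prod>i\<in>(UNIV::'d set). 2 / \<delta> * \<bar>u i\<bar>)"
    proof (intro prod_mono conjI)
      fix i
      have "1 \<le> \<bar>u i\<bar> / \<delta>" using \<mu>_le[of i] \<open>\<delta> \<le> \<mu>\<close> \<delta>0 by simp
      then show "real (m i) \<le> 2 / \<delta> * \<bar>u i\<bar>" using m(1)[of i] by simp
    qed simp
    also have "\<dots> = (2 / \<delta>) ^ CARD('d) * (\<Prod>i\<in>UNIV. \<bar>u i\<bar>)" by (simp only: prod.distrib prod_constant)
    also have "\<dots> \<le> (2 / \<delta>) ^ CARD('d) * \<psi>"
      using less \<delta>0 by (intro mult_left_mono) (auto simp: u_dist)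
    finally show ?thesis by (simp add: power_divide)
  next
    assume "j = 0"
    then have \<delta>\<psi>: "\<delta> = \<psi>" by (simp add: \<delta>_def)
    have "(\<Prod>i\<in>UNIV. real (m i)) = real (m k) * (\<Prod>i\<in>UNIV - {k}. real (m i))" by (rule prod.remove) auto
    also have "\<dots> \<le> 2 * (\<Prod>i\<in>UNIV - {k}. 1 / \<delta>)"
      using mk m_le by (intro mult_mono prod_mono) (auto intro: prod_nonneg)
    also have "\<dots> = 2 * (1 / \<delta>) ^ (CARD('d) - 1)" by (simp add: card_Diff_singleton)
    also have "\<dots> = 2 * \<psi> / \<delta> ^ CARD('d)"
      using \<psi> power_eq_if[of \<psi> "CARD('d)"] by (simp add: \<delta>\<psi> power_divide)
    also have "\<dots> \<le> 2 ^ CARD('d) * \<psi> / \<delta> ^ CARD('d)"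
      using \<psi> \<delta>0 self_le_power[of "2::real" "CARD('d)"] by (intro divide_right_mono mult_right_mono) auto
    finally show ?thesis .
  qed
  ultimately have "v \<in> cell_indices q \<theta> \<delta> (2 ^ CARD('d) * \<psi> / \<delta> ^ CARD('d)) k"
    "x \<in> approx_cell q \<theta> \<delta> v" by (auto simp: cell_indices_def v_def)
  then show ?thesis using \<delta>_half unfolding \<delta>_def by blast
qed

text \<open>Number of cells times growth of the gauge, with powers collected: the exponent of
  \<open>\<psi>\<close> is \<open>1 - d\<close> for every \<open>\<eta>\<close>, while the exponent
  of \<open>2 ^ j\<close> is negative once \<open>\<eta> > s - d + 1\<close>.\<close>

lemma level_exponents:
  fixes \<psi> \<eta> s :: real
  assumes \<psi>: "\<psi> > 0" and d: "d \<ge> 1"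
  shows "(2 ^ d * \<psi> / (2 ^ j * \<psi>) ^ d) powr \<eta> * ((1 / (2 ^ j * \<psi>)) powr (1 - \<eta>)) ^ (d - 1) * (2 ^ j) powr s
    = (2 ^ d) powr \<eta> * \<psi> powr (1 - real d) * (2 powr (s - \<eta> - (real d - 1))) ^ j"
proof -
  define T :: real where "T = 2 ^ j"
  have T: "T > 0" by (simp add: T_def)
  have rd: "real (d - 1) = real d - 1" using d by simp
  have "2 ^ d * \<psi> / (T * \<psi>) ^ d = 2 ^ d * (\<psi> powr (1 - real d) * T powr (- real d))"
    using T \<psi> by (simp add: powr_diff powr_minus_divide powr_realpow power_mult_distrib field_simps)
  then have X: "(2 ^ d * \<psi> / (T * \<psi>) ^ d) powr \<eta>
      = (2 ^ d) powr \<eta> * (\<psi> powr ((1 - real d) * \<eta>) * T powr (- real d * \<eta>))"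
    using T \<psi> by (simp add: powr_mult powr_powr)
  have "((1 / (T * \<psi>)) powr (1 - \<eta>)) ^ (d - 1) = (1 / (T * \<psi>)) powr ((real d - 1) * (1 - \<eta>))"
    using T \<psi> by (subst powr_power) (simp_all only: rd, simp)
  also have "\<dots> = T powr (- ((real d - 1) * (1 - \<eta>))) * \<psi> powr (- ((real d - 1) * (1 - \<eta>)))"
    using T \<psi> by (simp add: powr_divide powr_mult powr_minus_divide)
  finally have Y: "((1 / (T * \<psi>)) powr (1 - \<eta>)) ^ (d - 1)
    = T powr (- ((real d - 1) * (1 - \<eta>))) * \<psi> powr (- ((real d - 1) * (1 - \<eta>)))" .
  have Z: "(2 powr (s - \<eta> - (real d - 1))) ^ j = T powr (s - \<eta> - (real d - 1))"
    by (simp add: T_def powr_power flip: powr_realpow powr_powr) (simp add: powr_powr mult.commute)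
  have "\<psi> powr ((1 - real d) * \<eta>) * \<psi> powr (- ((real d - 1) * (1 - \<eta>)))
      = \<psi> powr ((1 - real d) * \<eta> + - ((real d - 1) * (1 - \<eta>)))" by (simp only: powr_add)
  also have "(1 - real d) * \<eta> + - ((real d - 1) * (1 - \<eta>)) = 1 - real d" by (simp add: algebra_simps)
  finally have P: "\<psi> powr ((1 - real d) * \<eta>) * \<psi> powr (- ((real d - 1) * (1 - \<eta>))) = \<psi> powr (1 - real d)" .
  have "T powr (- real d * \<eta>) * T powr (- ((real d - 1) * (1 - \<eta>))) * T powr s
      = T powr (- real d * \<eta> + - ((real d - 1) * (1 - \<eta>)) + s)" by (simp only: powr_add)
  also have "- real d * \<eta> + - ((real d - 1) * (1 - \<eta>)) + s = s - \<eta> - (real d - 1)" by (simp add: algebra_simps)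
  finally have R: "T powr (- real d * \<eta>) * T powr (- ((real d - 1) * (1 - \<eta>))) * T powr s
    = T powr (s - \<eta> - (real d - 1))" .
  show ?thesis
    unfolding T_def[symmetric] X Y Z P[symmetric] R[symmetric] by (simp only: mult_ac)
qed

text \<open>The cells of one level number at most \<open>CARD('d)\<close> times the bound for a
  fixed \<open>k\<close>. Since the diameter bound is \<open>CARD('d) * 2 ^ j\<close> times
  \<open>\<psi> / q\<close>, the growth condition compares their gauge with
  \<open>f (\<psi> / q)\<close>.\<close>

lemma hausdorff_premeasure_approx_level_le:
  fixes \<theta> :: "real ^ 'd" and f :: "real \<Rightarrow> real"
  assumes fpos: "\<And>r. r > 0 \<Longrightarrow> f r > 0" and fmono: "\<And>x y. 0 < x \<Longrightarrow> x \<le> y \<Longrightarrow> f x \<le> f y"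
    and growth: "\<And>x y. 0 < x \<Longrightarrow> x \<le> y \<Longrightarrow> f y \<le> C * (y / x) powr s * f x"
    and \<eta>: "0 \<le> \<eta>" "\<eta> < 1"
    and q: "q \<ge> 1" and \<psi>: "\<psi> > 0" and \<delta>_half: "2 ^ j * \<psi> \<le> 1 / 2" and \<rho>: "real CARD('d) / real q \<le> \<rho>"
  shows "hausdorff_premeasure f \<rho> (\<Union>k. \<Union>v\<in>cell_indices q \<theta> (2 ^ j * \<psi>) (2 ^ CARD('d) * \<psi> / (2 ^ j * \<psi>) ^ CARD('d)) k.
           approx_cell q \<theta> (2 ^ j * \<psi>) v)
    \<le> ennreal (real CARD('d) * ((2 ^ CARD('d)) powr \<eta> * (6 ^ CARD('d) * (2 / (1 - \<eta>) ^ (CARD('d) - 1)))) *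
        (C * real CARD('d) powr s) *
        (real q ^ CARD('d) * \<psi> powr (1 - real CARD('d)) * f (\<psi> / real q)) *
        (2 powr (s - \<eta> - (real CARD('d) - 1))) ^ j)"
proof -
  define d where "d = CARD('d)"
  have d1: "d \<ge> 1" by (simp add: d_def Suc_le_eq)
  define \<delta> where "\<delta> = 2 ^ j * \<psi>"
  have \<delta>: "\<delta> > 0" "\<delta> \<le> 1 / 2" using \<psi> \<delta>_half by (auto simp: \<delta>_def)
  define X where "X = 2 ^ d * \<psi> / \<delta> ^ d"
  have X: "X > 0" using \<psi> \<delta> by (simp add: X_def)
  define Z where "Z = Sigma (UNIV :: 'd set) (cell_indices q \<theta> \<delta> X)"
  define D where "D = real d * \<delta> / real q"
  have D: "D > 0" using d1 \<delta> q by (simp add: D_def)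
  have D\<rho>: "D \<le> \<rho>"
  proof -
    have "D \<le> real d * 1 / real q" unfolding D_def using \<delta> by (intro divide_right_mono mult_left_mono) auto
    then show ?thesis using \<rho> by (simp add: d_def)
  qed
  define N where "N = X powr \<eta> * ((6 * real q) ^ d * (2 * ((1 / \<delta>) powr (1 - \<eta>) / (1 - \<eta>)) ^ (d - 1)))"
  have fD: "f D \<le> C * real d powr s * (2 ^ j) powr s * f (\<psi> / real q)"
  proof -
    have "\<psi> \<le> real d * \<delta>"
    proof -
      have "1 * (1 * \<psi>) \<le> real d * (2 ^ j * \<psi>)" using d1 \<psi> by (intro mult_mono) auto
      then show ?thesis by (simp add: \<delta>_def)
    qed
    then have "f D \<le> C * (D / (\<psi> / real q)) powr s * f (\<psi> / real q)"
      unfolding D_def using \<psi> q by (intro growth divide_right_mono) auto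
    also have "D / (\<psi> / real q) = real d * 2 ^ j" using \<psi> q by (simp add: D_def \<delta>_def)
    finally show ?thesis by (simp add: powr_mult mult_ac)
  qed
  have "hausdorff_premeasure f \<rho> (\<Union>k. \<Union>v\<in>cell_indices q \<theta> \<delta> X k. approx_cell q \<theta> \<delta> v)
      \<le> (\<Sum>z\<in>Z. diam_weight f (approx_cell q \<theta> \<delta> (snd z)))"
  proof (rule hausdorff_premeasure_finite_cover)
    show "finite Z" by (auto simp: Z_def finite_cell_indices)
    show "(\<Union>k. \<Union>v\<in>cell_indices q \<theta> \<delta> X k. approx_cell q \<theta> \<delta> v) \<subseteq> (\<Union>z\<in>Z. approx_cell q \<theta> \<delta> (snd z))"
      by (auto simp: Z_def)
    show "\<rho> \<ge> 0" using D D\<rho> by simp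
    show "bounded (approx_cell q \<theta> \<delta> (snd z)) \<and> diameter (approx_cell q \<theta> \<delta> (snd z)) \<le> \<rho>" for z
      using approx_cell_small[OF q \<delta>(1), of \<theta> "snd z"] D\<rho> by (simp add: D_def d_def)
  qed
  also have "\<dots> \<le> (\<Sum>z\<in>Z. ennreal (f D))"
  proof (rule sum_mono)
    fix z
    have "0 \<le> diameter (approx_cell q \<theta> \<delta> (snd z))" "diameter (approx_cell q \<theta> \<delta> (snd z)) \<le> D"
      using approx_cell_small[OF q \<delta>(1), of \<theta> "snd z"] by (auto simp: D_def d_def diameter_ge_0)
    then show "diam_weight f (approx_cell q \<theta> \<delta> (snd z)) \<le> ennreal (f D)"
      by (auto simp: diam_weight_def intro!: ennreal_leI fmono)
  qed
  also have "\<dots> = ennreal (real (card Z) * f D)"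
    by (simp add: ennreal_mult' ennreal_of_nat_eq_real_of_nat)
  also have "\<dots> \<le> ennreal (real d * N * (C * real d powr s * (2 ^ j) powr s * f (\<psi> / real q)))"
  proof (intro ennreal_leI mult_mono)
    have "real (card Z) = (\<Sum>k\<in>(UNIV::'d set). real (card (cell_indices q \<theta> \<delta> X k)))"
      unfolding Z_def by (subst card_SigmaI) (auto simp: finite_cell_indices)
    also have "\<dots> \<le> (\<Sum>k\<in>(UNIV::'d set). N)"
      unfolding N_def d_def by (intro sum_mono card_cell_indices_le q \<delta> X \<eta>)
    finally show "real (card Z) \<le> real d * N" by (simp add: d_def)
    show "0 \<le> real d * N" using X \<eta> by (simp add: N_def)
  qed (use fD fpos[OF D] in auto)
  also have "real d * N * (C * real d powr s * (2 ^ j) powr s * f (\<psi> / real q))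
      = real d * (6 ^ d * (2 / (1 - \<eta>) ^ (d - 1))) * (C * real d powr s) * (real q ^ d * f (\<psi> / real q)) *
        (X powr \<eta> * ((1 / \<delta>) powr (1 - \<eta>)) ^ (d - 1) * (2 ^ j) powr s)"
    by (simp add: N_def power_divide power_mult_distrib)
  also have "\<dots> = real d * ((2 ^ d) powr \<eta> * (6 ^ d * (2 / (1 - \<eta>) ^ (d - 1)))) * (C * real d powr s) *
        (real q ^ d * \<psi> powr (1 - real d) * f (\<psi> / real q)) * (2 powr (s - \<eta> - (real d - 1))) ^ j"
    unfolding X_def \<delta>_def level_exponents[OF \<psi> d1] by (simp only: mult_ac)
  finally show ?thesis unfolding X_def \<delta>_def d_def .
qed

text \<open>The levels sum to a geometric series. The constant \<open>K\<close> is uniform in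
  \<open>q\<close>, \<open>\<psi>\<close>, \<open>\<rho>\<close> and
  \<open>\<theta>\<close>.\<close>

lemma hausdorff_premeasure_approx_set_le:
  fixes f :: "real \<Rightarrow> real"
  assumes fpos: "\<And>r. r > 0 \<Longrightarrow> f r > 0" and fmono: "\<And>x y. 0 < x \<Longrightarrow> x \<le> y \<Longrightarrow> f x \<le> f y"
    and growth: "\<And>x y. 0 < x \<Longrightarrow> x \<le> y \<Longrightarrow> f y \<le> C * (y / x) powr s * f x" and C: "C \<ge> 1"
    and s: "real CARD('d) - 1 < s" "s < real CARD('d)"
  obtains K where "K \<ge> 0" and "\<And>q \<psi> \<rho> (\<theta> :: real ^ 'd). q \<ge> 1 \<Longrightarrow> 0 < \<psi> \<Longrightarrow> \<psi> \<le> 1 / 2 \<Longrightarrow>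
    real CARD('d) / real q \<le> \<rho> \<Longrightarrow>
    hausdorff_premeasure f \<rho> {x \<in> unit_cube. (\<Prod>i\<in>UNIV. dist_nearest_int (real q * x $ i - \<theta> $ i)) < \<psi>}
      \<le> ennreal (K * (real q ^ CARD('d) * \<psi> powr (1 - real CARD('d)) * f (\<psi> / real q)))"
proof -
  \<comment> \<open>The midpoint of \<open>s - d + 1\<close> and \<open>1\<close>; the level
    exponent becomes \<open>(s - d) / 2 < 0\<close>.\<close>
  define \<eta> where "\<eta> = (s - real CARD('d) + 2) / 2"
  have \<eta>: "0 \<le> \<eta>" "\<eta> < 1" using s by (auto simp: \<eta>_def)
  define z where "z = 2 powr (s - \<eta> - (real CARD('d) - 1))"
  have "s - \<eta> - (real CARD('d) - 1) < 0" using s by (simp add: \<eta>_def field_simps)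
  then have z: "0 \<le> z" "z < 1"
    using powr_less_cancel_iff[of 2 "s - \<eta> - (real CARD('d) - 1)" 0] by (auto simp: z_def)
  define K\<^sub>0 where "K\<^sub>0 = real CARD('d) * ((2 ^ CARD('d)) powr \<eta> * (6 ^ CARD('d) * (2 / (1 - \<eta>) ^ (CARD('d) - 1)))) *
        (C * real CARD('d) powr s)"
  have K0: "K\<^sub>0 \<ge> 0" using \<eta> C by (simp add: K\<^sub>0_def)
  have "hausdorff_premeasure f \<rho> {x \<in> unit_cube. (\<Prod>i\<in>UNIV. dist_nearest_int (real q * x $ i - \<theta> $ i)) < \<psi>}
      \<le> ennreal (K\<^sub>0 / (1 - z) * (real q ^ CARD('d) * \<psi> powr (1 - real CARD('d)) * f (\<psi> / real q)))"
    if q: "q \<ge> 1" and \<psi>: "0 < \<psi>" "\<psi> \<le> 1 / 2" and \<rho>: "real CARD('d) / real q \<le> \<rho>"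
    for q \<psi> \<rho> and \<theta> :: "real ^ 'd"
  proof -
    define a where "a = real q ^ CARD('d) * \<psi> powr (1 - real CARD('d)) * f (\<psi> / real q)"
    have a: "a \<ge> 0" using fpos[of "\<psi> / real q"] \<psi> q by (simp add: a_def less_imp_le)
    define A where "A = (\<lambda>j. if 2 ^ j * \<psi> \<le> 1 / 2 then
      (\<Union>k. \<Union>v\<in>cell_indices q \<theta> (2 ^ j * \<psi>) (2 ^ CARD('d) * \<psi> / (2 ^ j * \<psi>) ^ CARD('d)) k.
        approx_cell q \<theta> (2 ^ j * \<psi>) v) else {})"
    have "{x \<in> unit_cube. (\<Prod>i\<in>UNIV. dist_nearest_int (real q * x $ i - \<theta> $ i)) < \<psi>} \<subseteq> (\<Union>j. A j)"
    proof
      fix x assume "x \<in> {x \<in> unit_cube. (\<Prod>i\<in>UNIV. dist_nearest_int (real q * x $ i - \<theta> $ i)) < \<psi>}"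
      then obtain j k v where j: "2 ^ j * \<psi> \<le> 1 / 2"
        "v \<in> cell_indices q \<theta> (2 ^ j * \<psi>) (2 ^ CARD('d) * \<psi> / (2 ^ j * \<psi>) ^ CARD('d)) k"
        "x \<in> approx_cell q \<theta> (2 ^ j * \<psi>) v"
        using exists_approx_cell[OF q \<psi>, of x \<theta>] by blast
      then have "x \<in> A j" unfolding A_def by auto
      then show "x \<in> (\<Union>j. A j)" by blast
    qed
    then have "hausdorff_premeasure f \<rho> {x \<in> unit_cube. (\<Prod>i\<in>UNIV. dist_nearest_int (real q * x $ i - \<theta> $ i)) < \<psi>}
        \<le> (\<Sum>j. hausdorff_premeasure f \<rho> (A j))"
      by (rule hausdorff_premeasure_countable_subadditive)
    also have "\<dots> \<le> (\<Sum>j. ennreal (K\<^sub>0 * a * z ^ j))"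
    proof (intro suminf_le summableI)
      fix j
      show "hausdorff_premeasure f \<rho> (A j) \<le> ennreal (K\<^sub>0 * a * z ^ j)"
      proof (cases "2 ^ j * \<psi> \<le> 1 / 2")
        case True
        then show ?thesis
          using hausdorff_premeasure_approx_level_le[OF fpos fmono growth \<eta> q \<psi>(1) True \<rho>, of \<theta>]
          by (simp add: A_def K\<^sub>0_def a_def z_def)
      next
        case False
        have "0 \<le> real CARD('d) / real q" by simp
        with \<rho> have "\<rho> \<ge> 0" by linarith
        then show ?thesis
          using hausdorff_premeasure_finite_cover[of "{} :: nat set" "{} :: (real ^ 'd) set" "\<lambda>_. {}" \<rho> f] False by (simp add: A_def)
      qed
    qed
    also have "\<dots> = ennreal (K\<^sub>0 / (1 - z) * a)"
    proof (subst suminf_ennreal2)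
      show "summable (\<lambda>j. K\<^sub>0 * a * z ^ j)" using z by (intro summable_mult summable_geometric) simp
      have "(\<Sum>j. K\<^sub>0 * a * z ^ j) = K\<^sub>0 * a * (\<Sum>j. z ^ j)"
        using z by (intro suminf_mult summable_geometric) simp
      then show "ennreal (\<Sum>j. K\<^sub>0 * a * z ^ j) = ennreal (K\<^sub>0 / (1 - z) * a)"
        using z by (simp add: suminf_geometric)
    qed (use K0 a z in auto)
    finally show ?thesis unfolding a_def .
  qed
  moreover have "K\<^sub>0 / (1 - z) \<ge> 0" using K0 z by simp
  ultimately show ?thesis by (intro that)
qed

section \<open>Zero or infinite measure according to the series\<close>

theorem theorem3:
  fixes \<theta> :: "real ^ 'd" and \<psi> :: "nat \<Rightarrow> real" and f :: "real \<Rightarrow> real"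
  assumes psi_pos: "\<And>q. q \<ge> 1 \<Longrightarrow> \<psi> q > 0"
    and dim_f: "dimension_function f"
    and cond_I: "\<exists>s C. real CARD('d) - 1 < s \<and> s < real CARD('d) \<and> C > 0 \<and>
                   (\<forall>x y. 0 < x \<and> x < y \<longrightarrow> f y \<le> C * (y / x) powr s * f x)"
    and cond_II: "mono_on {0<..} (\<lambda>x. x powi (1 - int CARD('d)) * f x)"
  shows "(approx_series CARD('d) \<psi> f < \<infinity> \<longrightarrow>
            hausdorff_measure f (mult_approx_set \<psi> \<theta> \<inter> unit_cube) = 0) \<and>
         (approx_series CARD('d) \<psi> f = \<infinity> \<and> (mono_on {1..} \<psi> \<or> antimono_on {1..} \<psi>) \<longrightarrow>
            hausdorff_measure f (mult_approx_set \<psi> \<theta> \<inter> unit_cube) = \<infinity>)"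
proof -
  define d where "d = CARD('d)"
  have d1: "d \<ge> 1" by (simp add: d_def Suc_le_eq)
  obtain s C\<^sub>0 where s: "real d - 1 < s" "s < real d" and C0: "C\<^sub>0 > 0"
    and growth0: "\<And>x y. 0 < x \<Longrightarrow> x < y \<Longrightarrow> f y \<le> C\<^sub>0 * (y / x) powr s * f x"
    using cond_I unfolding d_def by blast
  have fpos: "f r > 0" if "r > 0" for r using dim_f that by (simp add: dimension_function_def)
  have fmono: "f x \<le> f y" if "0 < x" "x \<le> y" for x y
    using dim_f that by (auto simp: dimension_function_def mono_on_def)
  have f0: "(f \<longlongrightarrow> 0) (at_right 0)" using dim_f by (simp add: dimension_function_def)
  \<comment> \<open>A constant of at least \<open>1\<close> extends the growth condition to
    \<open>x = y\<close>.\<close>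
  define C where "C = max 1 C\<^sub>0"
  have C: "C \<ge> 1" by (simp add: C_def)
  have fgrowth: "f y \<le> C * (y / x) powr s * f x" if xy: "0 < x" "x \<le> y" for x y
  proof (cases "x = y")
    case True
    then show ?thesis using xy C fpos[of x] by simp
  next
    case False
    then have "f y \<le> C\<^sub>0 * (y / x) powr s * f x" using xy by (intro growth0) auto
    also have "\<dots> \<le> C * (y / x) powr s * f x"
      using fpos[OF xy(1)] by (intro mult_right_mono) (auto simp: C_def)
    finally show ?thesis .
  qed
  have powi: "x powi (1 - int d) = x powr (1 - real d)" if "x > 0" for x :: real
    using that powr_real_of_int'[of x "1 - int d"] by simp
  define g where "g = (\<lambda>x. x powr (1 - real d) * f x)"
  interpret gauge g "s - (real d - 1)" C
  proof
    fix x y :: real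
    assume x: "0 < x"
    then show "0 < g x" using fpos by (simp add: g_def)
    assume xy: "x \<le> y"
    then have "x powi (1 - int d) * f x \<le> y powi (1 - int d) * f y"
      using x cond_II by (auto simp: mono_on_def d_def)
    then show "g x \<le> g y" using x xy by (simp add: powi g_def)
    have "g y \<le> y powr (1 - real d) * (C * (y / x) powr s * f x)"
      unfolding g_def using fgrowth[OF x xy] by (intro mult_left_mono) auto
    also have "y powr (1 - real d) = (y / x) powr (1 - real d) * x powr (1 - real d)"
      using x xy by (simp add: powr_divide)
    also have "(y / x) powr (1 - real d) * x powr (1 - real d) * (C * (y / x) powr s * f x)
        = C * (y / x) powr (s - (real d - 1)) * g x"
    proof -
      have "(y / x) powr (s - (real d - 1)) = (y / x) powr (1 - real d) * (y / x) powr s"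
        by (simp add: powr_add[symmetric] algebra_simps)
      then show ?thesis by (simp add: g_def)
    qed
    finally show "g y \<le> C * (y / x) powr (s - (real d - 1)) * g x" .
  qed (use s C in auto)
  have fg: "f r = r ^ (d - 1) * g r" if "r > 0" for r
  proof -
    have "r ^ (d - 1) * r powr (1 - real d) = r powr (real d - 1) * r powr (1 - real d)"
      using that d1 powr_realpow[of r "d - 1"] by simp
    also have "\<dots> = 1" using that by (simp add: powr_add[symmetric])
    finally show ?thesis by (simp add: g_def)
  qed
  define T where "T = (\<lambda>q. real q ^ d * \<psi> q powr (1 - real d) * f (\<psi> q / real q))"
  have series: "approx_series d \<psi> f = (\<Sum>n. ennreal (T (Suc n)))"
    unfolding approx_series_def Let_def T_def using psi_pos by (simp add: powi)
  have T_eq: "T q = real q * g (\<psi> q / real q)" if "q \<ge> 1" for q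
  proof -
    have "real q * (\<psi> q / real q) powr (1 - real d) = real q ^ d * \<psi> q powr (1 - real d)"
      using that psi_pos[OF that] by (simp add: powr_divide powr_diff powr_realpow)
    then show ?thesis by (simp add: T_def g_def mult.assoc[symmetric])
  qed
  have Tpos: "T q > 0" if "q \<ge> 1" for q
    unfolding T_eq[OF that] using that psi_pos[OF that] by (intro mult_pos_pos pos) auto
  have conv: "hausdorff_measure f (mult_approx_set \<psi> \<theta> \<inter> unit_cube) = 0" if fin: "approx_series d \<psi> f < \<infinity>"
  proof -
    have S: "summable (\<lambda>n. T (Suc n))"
      using fin Tpos unfolding series by (intro summable_suminf_not_top) (auto simp: less_imp_le)
    have "(\<lambda>n. T (Suc n)) \<longlonglongrightarrow> 0" using S by (rule summable_LIMSEQ_zero)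
    moreover have "g 1 / (2 * C) > 0" using pos[of 1] C by simp
    ultimately have "\<forall>\<^sub>F n in sequentially. T (Suc n) < g 1 / (2 * C)" by (rule order_tendstoD)
    then obtain N\<^sub>1 where N1: "\<And>n. n \<ge> N\<^sub>1 \<Longrightarrow> T (Suc n) < g 1 / (2 * C)"
      by (auto simp: eventually_sequentially)
    \<comment> \<open>The cell cover needs \<open>\<psi> q \<le> 1 / 2\<close>. Convergence ensures
      this eventually, since a larger value keeps the term above
      \<open>g 1 / (2 * C)\<close>.\<close>
    have half: "\<psi> (Suc n) \<le> 1 / 2" if "n \<ge> N\<^sub>1" for n
    proof (rule ccontr)
      assume c: "\<not> \<psi> (Suc n) \<le> 1 / 2"
      define q where "q = real (Suc n)"
      have q: "q \<ge> 1" by (simp add: q_def)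
      have "1 / (2 * q) * g 1 \<le> C * 1 * g (1 / (2 * q))" using q by (intro linear_growth) auto
      then have "g 1 / (2 * C) \<le> q * g (1 / (2 * q))" using q C by (simp add: field_simps)
      also have "\<dots> \<le> q * g (\<psi> (Suc n) / q)"
        using c q by (intro mult_left_mono mono) (auto simp: field_simps)
      also have "\<dots> = T (Suc n)" by (subst T_eq) (auto simp: q_def)
      finally show False using N1[OF that] by simp
    qed
    obtain K where K: "K \<ge> 0" and cover: "\<And>q \<psi> \<rho> (\<theta> :: real ^ 'd). q \<ge> 1 \<Longrightarrow> 0 < \<psi> \<Longrightarrow> \<psi> \<le> 1 / 2 \<Longrightarrow>
      real CARD('d) / real q \<le> \<rho> \<Longrightarrow>
      hausdorff_premeasure f \<rho> {x \<in> unit_cube. (\<Prod>i\<in>UNIV. dist_nearest_int (real q * x $ i - \<theta> $ i)) < \<psi>}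
        \<le> ennreal (K * (real q ^ CARD('d) * \<psi> powr (1 - real CARD('d)) * f (\<psi> / real q)))"
      using fpos fmono fgrowth C s[unfolded d_def] by (rule hausdorff_premeasure_approx_set_le) (assumption | rule that)+
    have "hausdorff_premeasure f \<rho> (mult_approx_set \<psi> \<theta> \<inter> unit_cube) \<le> 0" if \<rho>: "\<rho> > 0" for \<rho>
    proof (rule ennreal_le_epsilon)
      fix e :: real assume e: "e > 0"
      have SK: "summable (\<lambda>n. K * T (Suc n))" using S by (rule summable_mult)
      obtain N\<^sub>2 where N2: "\<And>n. n \<ge> N\<^sub>2 \<Longrightarrow> norm (\<Sum>i. K * T (Suc (i + n))) < e"
        using suminf_exist_split[OF e SK] by blast
      obtain N\<^sub>3 :: nat where N3: "real d / \<rho> < real N\<^sub>3" using reals_Archimedean2 by blast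
      \<comment> \<open>Beyond \<open>N\<close> the values of \<open>\<psi>\<close> are at most
        \<open>1 / 2\<close>, the tail is below \<open>e\<close>, and the cells have diameter at
        most \<open>\<rho>\<close>.\<close>
      define N where "N = Max {N\<^sub>1, N\<^sub>2, N\<^sub>3}"
      have N: "N \<ge> N\<^sub>1" "N \<ge> N\<^sub>2" "N \<ge> N\<^sub>3" by (auto simp: N_def)
      have "mult_approx_set \<psi> \<theta> \<inter> unit_cube \<subseteq> (\<Union>i. {x \<in> unit_cube.
          (\<Prod>j\<in>UNIV. dist_nearest_int (real (Suc (i + N)) * x $ j - \<theta> $ j)) < \<psi> (Suc (i + N))})"
      proof
        fix x assume x: "x \<in> mult_approx_set \<psi> \<theta> \<inter> unit_cube"
        then obtain q where q: "q > N" "(\<Prod>j\<in>UNIV. dist_nearest_int (real q * x $ j - \<theta> $ j)) < \<psi> q"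
          unfolding mult_approx_set_def infinite_nat_iff_unbounded by blast
        from q(1) obtain i where "q = Suc (i + N)" by (metis add.commute less_imp_Suc_add)
        then show "x \<in> (\<Union>i. {x \<in> unit_cube.
          (\<Prod>j\<in>UNIV. dist_nearest_int (real (Suc (i + N)) * x $ j - \<theta> $ j)) < \<psi> (Suc (i + N))})"
          using q x by blast
      qed
      then have "hausdorff_premeasure f \<rho> (mult_approx_set \<psi> \<theta> \<inter> unit_cube)
        \<le> (\<Sum>i. hausdorff_premeasure f \<rho> {x \<in> unit_cube.
          (\<Prod>j\<in>UNIV. dist_nearest_int (real (Suc (i + N)) * x $ j - \<theta> $ j)) < \<psi> (Suc (i + N))})"
        by (rule hausdorff_premeasure_countable_subadditive)
      also have "\<dots> \<le> (\<Sum>i. ennreal (K * T (Suc (i + N))))"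
      proof (intro suminf_le summableI)
        fix i
        have "real N\<^sub>3 \<le> real (Suc (i + N))" using N(3) by simp
        with N3 have "real d / \<rho> \<le> real (Suc (i + N))" by linarith
        then have "real d / real (Suc (i + N)) \<le> \<rho>" using \<rho> by (simp add: field_simps del: of_nat_Suc)
        then show "hausdorff_premeasure f \<rho> {x \<in> unit_cube.
          (\<Prod>j\<in>UNIV. dist_nearest_int (real (Suc (i + N)) * x $ j - \<theta> $ j)) < \<psi> (Suc (i + N))}
            \<le> ennreal (K * T (Suc (i + N)))"
          unfolding T_def d_def using psi_pos half[of "i + N"] N(1) by (intro cover) auto
      qed
      also have "\<dots> = ennreal (\<Sum>i. K * T (Suc (i + N)))"
      proof (rule suminf_ennreal2)
        show "summable (\<lambda>i. K * T (Suc (i + N)))"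
          using SK summable_iff_shift[of "\<lambda>n. K * T (Suc n)" N] by simp
      qed (use K Tpos in \<open>auto simp: less_imp_le\<close>)
      also have "\<dots> \<le> ennreal e" using N2[OF N(2)] by (intro ennreal_leI) simp
      finally show "hausdorff_premeasure f \<rho> (mult_approx_set \<psi> \<theta> \<inter> unit_cube) \<le> 0 + ennreal e" by simp
    qed
    then have "hausdorff_measure f (mult_approx_set \<psi> \<theta> \<inter> unit_cube) \<le> 0"
      unfolding hausdorff_measure_eq_SUP by (intro SUP_least) auto
    then show ?thesis by simp
  qed
  have div: "hausdorff_measure f (mult_approx_set \<psi> \<theta> \<inter> unit_cube) = \<infinity>"
    if inf: "approx_series d \<psi> f = \<infinity>" and mono_\<psi>: "mono_on {1..} \<psi> \<or> antimono_on {1..} \<psi>"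
    using mono_\<psi>
  proof
    \<comment> \<open>Here \<open>\<psi> q \<ge> \<psi> 1\<close>, so the level radius
      \<open>\<psi> 1 / (2 * 2 ^ n)\<close> already gives divergence.\<close>
    assume inc: "mono_on {1..} \<psi>"
    show ?thesis
    proof (rule hausdorff_measure_mult_approx_set_infinite[OF f0 fg[unfolded d_def]])
      show "\<not> summable (\<lambda>n. 4 ^ n * g (\<psi> 1 / (2 * 2 ^ n)))" using psi_pos[of 1] by (intro constant_not_summable) simp
      show "0 < \<psi> 1 / (2 * 2 ^ n)" for n using psi_pos[of 1] by simp
      show "\<psi> 1 / (2 * 2 ^ n) < \<psi> q / real q" if q: "2 ^ n \<le> q" "q < 2 * 2 ^ n" for n q
      proof -
        have q1: "q \<ge> 1" using q(1) by (metis One_nat_def Suc_leI le_trans pos2 zero_less_power)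
        have "real q < real (2 * 2 ^ n)" using q(2) by (simp only: of_nat_less_iff)
        then have "\<psi> 1 / (2 * 2 ^ n) < \<psi> 1 / real q"
          using psi_pos[of 1] q1 by (intro divide_strict_left_mono) auto
        also have "\<dots> \<le> \<psi> q / real q"
          using inc q1 by (intro divide_right_mono) (auto simp: monotone_on_def)
        finally show ?thesis .
      qed
    qed auto
  next
    \<comment> \<open>The value at the excluded right end \<open>2 * 2 ^ n\<close> bounds the block
      from below; strictness comes from \<open>q < 2 * 2 ^ n\<close>.\<close>
    assume dec: "antimono_on {1..} \<psi>"
    show ?thesis
    proof (rule hausdorff_measure_mult_approx_set_infinite[OF f0 fg[unfolded d_def]])
      have "\<not> summable (\<lambda>n. T (Suc n))"
      proof
        assume "summable (\<lambda>n. T (Suc n))"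
        then have "approx_series d \<psi> f = ennreal (\<Sum>n. T (Suc n))"
          unfolding series using Tpos by (intro suminf_ennreal2) (auto simp: less_imp_le)
        then show False using inf by simp
      qed
      moreover have "T (Suc n) = real (Suc n) * g (\<psi> (Suc n) / real (Suc n))" for n
        by (rule T_eq) simp
      ultimately show "\<not> summable (\<lambda>n. 4 ^ n * g (\<psi> (2 * 2 ^ n) / (2 * 2 ^ n)))"
        using psi_pos dec by (intro dyadic_not_summable) auto
      show "0 < \<psi> (2 * 2 ^ n) / (2 * 2 ^ n)" for n using psi_pos[of "2 * 2 ^ n"] by simp
      show "\<psi> (2 * 2 ^ n) / (2 * 2 ^ n) < \<psi> q / real q" if q: "2 ^ n \<le> q" "q < 2 * 2 ^ n" for n q
      proof -
        have q1: "q \<ge> 1" using q(1) by (metis One_nat_def Suc_leI le_trans pos2 zero_less_power)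
        have "real q < real (2 * 2 ^ n)" using q(2) by (simp only: of_nat_less_iff)
        then have "\<psi> (2 * 2 ^ n) / (2 * 2 ^ n) < \<psi> (2 * 2 ^ n) / real q"
          using psi_pos[of "2 * 2 ^ n"] q1 by (intro divide_strict_left_mono) auto
        also have "\<dots> \<le> \<psi> q / real q"
          using dec q1 q(2) by (intro divide_right_mono) (auto simp: monotone_on_def)
        finally show ?thesis .
      qed
    qed auto
  qed
  show ?thesis using conv div unfolding d_def by blast
qed

end
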